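(* Let $(V,V^+)$ be an ordered $*$-vector space with order unit $e$, let $J$ be an order ideal of $V$, and put $J_{\mathbb R}:=J\cap V_h$. Define $$N_{J_{\mathbb R}} := \{ v \in V_h : \text{for all } r > 0 \text{ there exist } j,k \in J_{\mathbb R} \text{ such that } j + re + v \in V^+ \text{ and } k + re - v \in V^+ \},$$ and set $N_J := N_{J_{\mathbb R}} \oplus i N_{J_{\mathbb R}}$. Then $N_J$ is an order ideal of $V$. Furthermore, if $$(V/N_J)^+ := \{ v + N_J : \text{for all } r > 0 \text{ there exists } j \in J \text{ such that } j + re + v \in V^+ \},$$ then $(V/N_J, (V/N_J)^+ )$ is an ordered $*$-vector space with Archimedean order unit $e + N_J$, and the Archimedean quotient of $V$ by $J$ is unitally order isomorphic to $(V/N_J, (V/N_J)^+ )$.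
   Context: A $*$-vector space is a complex vector space $V$ with a conjugate-linear involution $*:V\to V$; $V_h:=\{x\in V: x^*=x\}$. An ordered $*$-vector space $(V,V^+)$ is a $*$-vector space $V$ with a nonempty subset $V^+\subseteq V_h$ closed under addition and under multiplication by scalars in $[0,\infty)$, such that $V^+\cap -V^+=\{0\}$. For $v,w\in V_h$ write $v\ge w$ if $v-w\in V^+$. An element $e\in V_h$ is an order unit if for every $x\in V_h$ there is a real $r>0$ with $re\ge x$; it is Archimedean if, in addition, whenever $x\in V_h$ and $re+x\ge0$ for all real $r>0$, then $x\ge 0$. A complex subspace $J\subseteq V$ is self-adjoint if $J=J^*$; a self-adjoint subspace $J$ is an order ideal if $p\in J\cap V^+$ and $0\le q\le p$ imply $q\in J$. For a self-adjoint subspace $J$, $V/J$ carries the involution $(v+J)^*=v^*+J$. If $J$ is an order ideal, $(V/J, V^++J)$, where $V^++J=\{v+J:v\in V^+\}$, is an ordered $*$-vector space with order unit $e+J$. Two ordered $*$-vector spaces with order units are unitally order isomorphic if there is a $\mathbb{C}$-linear bijection $\phi$ between them mapping order unit to order unit such that $v$ is positive if and only if $\phi(v)$ is positive. Archimedeanization: for an ordered $*$-vector space $(U,U^+)$ with order unit $u$, let $D := \{ v \in U_h : ru + v \in U^+ \text{ for all } r > 0 \}$, and let $N$ be the intersection of the kernels of all states on $U$ (equivalently $N=N_{\mathbb R}\oplus iN_{\mathbb R}$ with $N_{\mathbb R}=D\cap -D$), where a state is a $\mathbb{C}$-linear functional $f:U\to\mathbb{C}$ with $f(U^+)\subseteq[0,\infty)$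 and $f(u)=1$. The Archimedeanization of $U$ is $U/N$ with cone $\{v+N:v\in D\}$ and (Archimedean) order unit $u+N$. The Archimedean quotient of $V$ by $J$ is the Archimedeanization of $(V/J,V^++J)$ with order unit $e+J$. *)

theory Defs
  imports Complex_Main "HOL-Algebra.QuotRing" "Jordan_Normal_Form.VS_Connect"
begin

text \<open>
  A vector space in the sense of \<open>vectorspace\<close> is a \<open>module\<close> record, which inherits the ring fields
  \<open>mult\<close> and \<open>one\<close>. These two fields play no role: no axiom of \<open>vectorspace\<close> mentions them.
  The scalar field \<open>class_ring :: complex ring\<close> is the field of complex numbers.
\<close>

record 'a ostar = "(complex, 'a) module" +
  adj :: "'a \<Rightarrow> 'a"
  cone :: "'a set"

locale star_vectorspace = vectorspace "class_ring :: complex ring" V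
  for V :: "'a ostar" (structure) +
  assumes adj_closed: "v \<in> carrier V \<Longrightarrow> adj V v \<in> carrier V"
    and adj_add: "v \<in> carrier V \<Longrightarrow> w \<in> carrier V \<Longrightarrow> adj V (v \<oplus> w) = adj V v \<oplus> adj V w"
    and adj_smult: "v \<in> carrier V \<Longrightarrow> adj V (c \<odot> v) = cnj c \<odot> adj V v"
    and adj_adj: "v \<in> carrier V \<Longrightarrow> adj V (adj V v) = v"

definition herm :: "'a ostar \<Rightarrow> 'a set" where
  "herm V = {v \<in> carrier V. adj V v = v}"

locale ordered_star_vectorspace = star_vectorspace +
  assumes cone_nonempty: "cone V \<noteq> {}"
    and cone_herm: "cone V \<subseteq> herm V"
    and cone_add: "v \<in> cone V \<Longrightarrow> w \<in> cone V \<Longrightarrow> v \<oplus> w \<in> cone V"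
    and cone_smult: "v \<in> cone V \<Longrightarrow> r \<ge> 0 \<Longrightarrow> complex_of_real r \<odot> v \<in> cone V"
    and cone_proper: "cone V \<inter> a_inv V ` cone V = {\<zero>}"

definition ord_le :: "'a ostar \<Rightarrow> 'a \<Rightarrow> 'a \<Rightarrow> bool" where
  "ord_le V w v \<longleftrightarrow> w \<in> herm V \<and> v \<in> herm V \<and> v \<ominus>\<^bsub>V\<^esub> w \<in> cone V"

definition order_unit :: "'a ostar \<Rightarrow> 'a \<Rightarrow> bool" where
  "order_unit V e \<longleftrightarrow> e \<in> herm V \<and>
    (\<forall>x\<in>herm V. \<exists>r>0. ord_le V x (complex_of_real r \<odot>\<^bsub>V\<^esub> e))"

definition archimedean_order_unit :: "'a ostar \<Rightarrow> 'a \<Rightarrow> bool" where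
  "archimedean_order_unit V e \<longleftrightarrow> order_unit V e \<and>
    (\<forall>x\<in>herm V. (\<forall>r>0. ord_le V \<zero>\<^bsub>V\<^esub> (complex_of_real r \<odot>\<^bsub>V\<^esub> e \<oplus>\<^bsub>V\<^esub> x)) \<longrightarrow> ord_le V \<zero>\<^bsub>V\<^esub> x)"

definition selfadjoint_subspace :: "'a ostar \<Rightarrow> 'a set \<Rightarrow> bool" where
  "selfadjoint_subspace V J \<longleftrightarrow>
    VectorSpace.subspace (class_ring :: complex ring) J V \<and> adj V ` J = J"

definition order_ideal :: "'a ostar \<Rightarrow> 'a set \<Rightarrow> bool" where
  "order_ideal V J \<longleftrightarrow> selfadjoint_subspace V J \<and>
    (\<forall>p q. p \<in> J \<inter> cone V \<and> ord_le V \<zero>\<^bsub>V\<^esub> q \<and> ord_le V q p \<longrightarrow> q \<in> J)"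

text \<open>
  \<open>quot_space V J C\<close> is \<open>V/J\<close>, for a self-adjoint subspace \<open>J\<close>, with the cone \<open>{v + J. v \<in> C}\<close>,
  where \<open>C\<close> is a set of representatives in \<open>V\<close>. Its elements are the cosets of \<open>J\<close>. The unions defining
  \<open>smult\<close> and \<open>adj\<close> range over all representatives, all of which give the same coset: if \<open>X = v + J\<close>
  then \<open>c \<odot> X = c \<odot> v + J\<close> and \<open>adj X = adj v + J\<close>.
\<close>

definition quot_space :: "'a ostar \<Rightarrow> 'a set \<Rightarrow> 'a set \<Rightarrow> 'a set ostar" where
  "quot_space V J C =
    \<lparr>carrier = a_rcosets\<^bsub>V\<^esub> J, mult = rcoset_mult V J, one = J +>\<^bsub>V\<^esub> \<one>\<^bsub>V\<^esub>,
      zero = J, add = set_add V,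
      smult = (\<lambda>c X. \<Union>v\<in>X. J +>\<^bsub>V\<^esub> (c \<odot>\<^bsub>V\<^esub> v)),
      adj = (\<lambda>X. \<Union>v\<in>X. J +>\<^bsub>V\<^esub> adj V v),
      cone = (\<lambda>v. J +>\<^bsub>V\<^esub> v) ` C\<rparr>"

definition complex_space :: "(complex, complex) module" where
  "complex_space = \<lparr>carrier = UNIV, mult = (*), one = 1, zero = 0, add = (+), smult = (*)\<rparr>"

definition state :: "'a ostar \<Rightarrow> 'a \<Rightarrow> ('a \<Rightarrow> complex) \<Rightarrow> bool" where
  "state U u f \<longleftrightarrow> f \<in> LinearCombinations.module_hom class_ring U complex_space \<and>
    f ` cone U \<subseteq> complex_of_real ` {0..} \<and> f u = 1"

text \<open>If there are no states (the case \<open>U = 0\<close>), the intersection of their kernels is \<open>carrier U\<close>.\<close>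

definition state_kernel :: "'a ostar \<Rightarrow> 'a \<Rightarrow> 'a set" where
  "state_kernel U u = {v \<in> carrier U. \<forall>f. state U u f \<longrightarrow> f v = 0}"

definition arch_cone :: "'a ostar \<Rightarrow> 'a \<Rightarrow> 'a set" where
  "arch_cone U u = {v \<in> herm U. \<forall>r>0. complex_of_real r \<odot>\<^bsub>U\<^esub> u \<oplus>\<^bsub>U\<^esub> v \<in> cone U}"

definition archimedeanization :: "'a ostar \<Rightarrow> 'a \<Rightarrow> 'a set ostar" where
  "archimedeanization U u = quot_space U (state_kernel U u) (arch_cone U u)"

definition archimedeanization_unit :: "'a ostar \<Rightarrow> 'a \<Rightarrow> 'a set" where
  "archimedeanization_unit U u = state_kernel U u +>\<^bsub>U\<^esub> u"

definition arch_quotient :: "'a ostar \<Rightarrow> 'a \<Rightarrow> 'a set \<Rightarrow> 'a set set ostar" where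
  "arch_quotient V e J = archimedeanization (quot_space V J (cone V)) (J +>\<^bsub>V\<^esub> e)"

definition arch_quotient_unit :: "'a ostar \<Rightarrow> 'a \<Rightarrow> 'a set \<Rightarrow> 'a set set" where
  "arch_quotient_unit V e J = archimedeanization_unit (quot_space V J (cone V)) (J +>\<^bsub>V\<^esub> e)"

definition unitally_order_isomorphic :: "'a ostar \<Rightarrow> 'a \<Rightarrow> 'b ostar \<Rightarrow> 'b \<Rightarrow> bool" where
  "unitally_order_isomorphic V e W f \<longleftrightarrow>
    (\<exists>\<phi> \<in> LinearCombinations.module_hom class_ring V W. bij_betw \<phi> (carrier V) (carrier W) \<and> \<phi> e = f \<and>
      (\<forall>v\<in>carrier V. v \<in> cone V \<longleftrightarrow> \<phi> v \<in> cone W))"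

definition N_real :: "'a ostar \<Rightarrow> 'a \<Rightarrow> 'a set \<Rightarrow> 'a set" where
  "N_real V e J = {v \<in> herm V. \<forall>r>0. \<exists>j \<in> J \<inter> herm V. \<exists>k \<in> J \<inter> herm V.
    j \<oplus>\<^bsub>V\<^esub> complex_of_real r \<odot>\<^bsub>V\<^esub> e \<oplus>\<^bsub>V\<^esub> v \<in> cone V \<and>
    k \<oplus>\<^bsub>V\<^esub> complex_of_real r \<odot>\<^bsub>V\<^esub> e \<ominus>\<^bsub>V\<^esub> v \<in> cone V}"

text \<open>The sum below is direct because \<open>herm V \<inter> \<i> \<odot> herm V = {\<zero>}\<close>.\<close>

definition N_ideal :: "'a ostar \<Rightarrow> 'a \<Rightarrow> 'a set \<Rightarrow> 'a set" where
  "N_ideal V e J = N_real V e J <+>\<^bsub>V\<^esub> (\<lambda>v. \<i> \<odot>\<^bsub>V\<^esub> v) ` N_real V e J"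

definition N_quotient :: "'a ostar \<Rightarrow> 'a \<Rightarrow> 'a set \<Rightarrow> 'a set ostar" where
  "N_quotient V e J = quot_space V (N_ideal V e J)
    {v \<in> carrier V. \<forall>r>0. \<exists>j\<in>J. j \<oplus>\<^bsub>V\<^esub> complex_of_real r \<odot>\<^bsub>V\<^esub> e \<oplus>\<^bsub>V\<^esub> v \<in> cone V}"

end

theory Submission
  imports Defs
begin

text \<open>
  Call a convex cone \<open>Q\<close> of hermitian elements, containing \<open>0\<close> but not necessarily proper, a wedge.
  Its lineality space \<open>L = Q \<inter> -Q\<close> is a real subspace, and \<open>N = L + \<i>L\<close> is a self-adjoint subspace.
  In \<open>V/N\<close>, with the image of \<open>Q\<close> as cone, a hermitian \<open>v\<close> represents a positive element exactly
  when \<open>v \<in> Q\<close>. Hence \<open>V/N\<close> is an ordered \<open>*\<close>-vector space; if \<open>V\<^sup>+ \<subseteq> Q\<close>, then \<open>e + N\<close> is an order unit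
  of it, and it is Archimedean if \<open>Q\<close> contains every hermitian \<open>x\<close> with \<open>r e + x \<in> Q\<close> for all \<open>r > 0\<close>.

  All three quotients in question are of this kind. The space \<open>V/J\<close> comes from the wedge
  \<open>QJ = {v. \<exists>j. j + v \<in> V\<^sup>+}\<close>, whose lineality space consists of the hermitian elements of \<open>J\<close> because
  \<open>J\<close> is an order ideal. The space \<open>V/N\<^sub>J\<close> comes from the Archimedean closure \<open>PJ\<close> of \<open>QJ\<close>. The
  Archimedeanization of \<open>U = V/J\<close> comes from the Archimedean cone of \<open>U\<close>, which is the image of \<open>PJ\<close>;
  for this the common kernel of the states has to be the complexified lineality space of that cone
  (\<open>state_kernel_eq\<close>). The maps \<open>V \<rightarrow> V/N\<^sub>J\<close> and \<open>V \<rightarrow> U \<rightarrow> U/N\<close> are then linear surjections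
  with the same kernel under which the same elements become positive, so they induce the isomorphism.

  The description of the state kernel needs a Hahn-Banach argument (\<open>ex_negative_state\<close>): a
  hermitian element \<open>v\<close> outside the Archimedean cone is strictly negative in some state. By Zorn's
  lemma there is a wedge \<open>P\<close> that contains \<open>U\<^sup>+\<close> and \<open>-(r u + v)\<close> for some \<open>r > 0\<close>, and is maximal among
  those avoiding \<open>-u\<close>. Such a \<open>P\<close> contains \<open>x\<close> or \<open>-x\<close> for every hermitian \<open>x\<close>, and
  \<open>x \<mapsto> Inf {t. t u - x \<in> P}\<close> is then additive, and extends to the state sought.
\<close>

section \<open>Real and imaginary parts\<close>

text \<open>
  The hermitian elements with \<open>v = re_part V v + \<i> im_part V v\<close>.
\<close>

definition re_part :: "'a ostar \<Rightarrow> 'a \<Rightarrow> 'a" where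
  "re_part V v = (1 / 2) \<odot>\<^bsub>V\<^esub> (v \<oplus>\<^bsub>V\<^esub> adj V v)"

definition im_part :: "'a ostar \<Rightarrow> 'a \<Rightarrow> 'a" where
  "im_part V v = re_part V ((- \<i>) \<odot>\<^bsub>V\<^esub> v)"

context star_vectorspace
begin

lemma smult_in_carrier [simp, intro]: "v \<in> carrier V \<Longrightarrow> c \<odot> v \<in> carrier V"
  using smult_closed by simp

lemma smult_add_left: "v \<in> carrier V \<Longrightarrow> (a + b) \<odot> v = a \<odot> v \<oplus> b \<odot> v"
  using smult_l_distr by simp

lemma smult_add_right:
  "v \<in> carrier V \<Longrightarrow> w \<in> carrier V \<Longrightarrow> a \<odot> (v \<oplus> w) = a \<odot> v \<oplus> a \<odot> w"
  using smult_r_distr by simp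

lemma smult_smult: "v \<in> carrier V \<Longrightarrow> a \<odot> (b \<odot> v) = (a * b) \<odot> v"
  using smult_assoc1 by simp

lemma one_smult [simp]: "v \<in> carrier V \<Longrightarrow> 1 \<odot> v = v"
  using smult_one by simp

lemma zero_smult [simp]: "v \<in> carrier V \<Longrightarrow> 0 \<odot> v = \<zero>"
  using smult_l_null by simp

lemma smult_zero [simp]: "a \<odot> \<zero> = \<zero>"
  using smult_r_null by simp

lemma neg_eq_smult: "v \<in> carrier V \<Longrightarrow> \<ominus> v = (- 1) \<odot> v"
  using smult_l_minus[of 1 v] by (simp add: class_ring_simps)

lemma neg_zero [simp]: "\<ominus> \<zero> = \<zero>"
  by (simp add: neg_eq_smult)

lemma smult_neg: "v \<in> carrier V \<Longrightarrow> a \<odot> (\<ominus> v) = \<ominus> (a \<odot> v)"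
  by (simp add: neg_eq_smult smult_smult)

lemma minus_eq_smult:
  "v \<in> carrier V \<Longrightarrow> w \<in> carrier V \<Longrightarrow> v \<ominus> w = v \<oplus> (- 1) \<odot> w"
  by (simp add: a_minus_def neg_eq_smult)

lemmas vs_simps = smult_add_left smult_add_right smult_smult minus_eq_smult neg_eq_smult
  M.a_ac

lemma smult_cancel_half:
  assumes "v \<in> carrier V"
  shows "v = (1 / 2) \<odot> v \<oplus> (1 / 2) \<odot> v"
  using smult_add_left[of v "1/2" "1/2"] assms by simp

lemma adj_in_carrier [simp, intro]: "v \<in> carrier V \<Longrightarrow> adj V v \<in> carrier V"
  by (rule adj_closed)

lemma herm_carrier: "v \<in> herm V \<Longrightarrow> v \<in> carrier V"
  by (simp add: herm_def)

lemma adj_zero [simp]: "adj V \<zero> = \<zero>"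
  using adj_smult[of \<zero> 0] by simp

lemma adj_neg: "v \<in> carrier V \<Longrightarrow> adj V (\<ominus> v) = \<ominus> adj V v"
  using adj_smult[of v "- 1"] by (simp add: neg_eq_smult)

lemma herm_zero [simp]: "\<zero> \<in> herm V"
  by (simp add: herm_def)

lemma herm_add: "v \<in> herm V \<Longrightarrow> w \<in> herm V \<Longrightarrow> v \<oplus> w \<in> herm V"
  by (simp add: herm_def adj_add)

lemma herm_smult: "v \<in> herm V \<Longrightarrow> complex_of_real r \<odot> v \<in> herm V"
  by (simp add: herm_def adj_smult)

lemma herm_neg: "v \<in> herm V \<Longrightarrow> \<ominus> v \<in> herm V"
  by (simp add: herm_def adj_neg)

lemma herm_minus: "v \<in> herm V \<Longrightarrow> w \<in> herm V \<Longrightarrow> v \<ominus> w \<in> herm V"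
  by (simp add: a_minus_def herm_add herm_neg)

lemma re_part_herm: "v \<in> carrier V \<Longrightarrow> re_part V v \<in> herm V"
  by (simp add: herm_def re_part_def adj_smult adj_add adj_adj M.a_comm)

lemma im_part_herm: "v \<in> carrier V \<Longrightarrow> im_part V v \<in> herm V"
  by (simp add: im_part_def re_part_herm)

lemma re_part_carrier [simp, intro]: "v \<in> carrier V \<Longrightarrow> re_part V v \<in> carrier V"
  and im_part_carrier [simp, intro]: "v \<in> carrier V \<Longrightarrow> im_part V v \<in> carrier V"
  using re_part_herm im_part_herm herm_carrier by blast+

lemma re_part_of_herm: "v \<in> herm V \<Longrightarrow> re_part V v = v"
  using smult_cancel_half[of v] by (auto simp: herm_def re_part_def smult_add_right)

lemma im_part_of_herm: "v \<in> herm V \<Longrightarrow> im_part V v = \<zero>"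
  using smult_add_left[of v "- \<i>/2" "\<i>/2"]
  by (auto simp: herm_def im_part_def re_part_def adj_smult vs_simps)

lemma re_im_decomp:
  assumes v: "v \<in> carrier V"
  shows "v = re_part V v \<oplus> \<i> \<odot> im_part V v"
proof -
  let ?a = "(1/2) \<odot> v" and ?b = "(1/2) \<odot> adj V v"
  have "re_part V v \<oplus> \<i> \<odot> im_part V v = (?a \<oplus> ?b) \<oplus> (?a \<oplus> (- 1) \<odot> ?b)"
    using v by (simp add: re_part_def im_part_def adj_smult smult_add_right smult_smult)
  also have "\<dots> = (?a \<oplus> ?a) \<oplus> (?b \<oplus> (- 1) \<odot> ?b)"
    using v by (simp add: M.a_ac)
  also have "?b \<oplus> (- 1) \<odot> ?b = \<zero>"
    using v by (simp flip: neg_eq_smult add: M.r_neg)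
  finally show ?thesis
    using v smult_cancel_half[of v] by simp
qed

lemma re_part_add:
  "v \<in> carrier V \<Longrightarrow> w \<in> carrier V \<Longrightarrow> re_part V (v \<oplus> w) = re_part V v \<oplus> re_part V w"
  by (simp add: re_part_def adj_add smult_add_right M.a_ac)

lemma im_part_add:
  "v \<in> carrier V \<Longrightarrow> w \<in> carrier V \<Longrightarrow> im_part V (v \<oplus> w) = im_part V v \<oplus> im_part V w"
  by (simp add: im_part_def smult_add_right re_part_add)

lemma re_part_real_smult:
  "v \<in> carrier V \<Longrightarrow> re_part V (complex_of_real r \<odot> v) = complex_of_real r \<odot> re_part V v"
  by (simp add: re_part_def adj_smult smult_add_right smult_smult mult.commute)

lemma im_part_real_smult:
  "v \<in> carrier V \<Longrightarrow> im_part V (complex_of_real r \<odot> v) = complex_of_real r \<odot> im_part V v"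
  using re_part_real_smult[of "(- \<i>) \<odot> v" r]
  by (simp add: im_part_def smult_smult mult.commute)

lemma re_part_i_smult: "v \<in> carrier V \<Longrightarrow> re_part V (\<i> \<odot> v) = \<ominus> im_part V v"
  using re_part_real_smult[of "(- \<i>) \<odot> v" "- 1"]
  by (simp add: im_part_def smult_smult neg_eq_smult)

lemma im_part_i_smult: "v \<in> carrier V \<Longrightarrow> im_part V (\<i> \<odot> v) = re_part V v"
  by (simp add: im_part_def smult_smult)

lemma smult_Complex:
  "v \<in> carrier V \<Longrightarrow>
    c \<odot> v = complex_of_real (Re c) \<odot> v \<oplus> complex_of_real (Im c) \<odot> (\<i> \<odot> v)"
  by (simp add: smult_smult mult.commute flip: smult_add_left complex_eq)

lemma re_part_smult:
  "v \<in> carrier V \<Longrightarrow> re_part V (c \<odot> v) =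
    complex_of_real (Re c) \<odot> re_part V v \<ominus> complex_of_real (Im c) \<odot> im_part V v"
  by (subst smult_Complex)
    (simp_all add: re_part_add re_part_real_smult re_part_i_smult a_minus_def smult_neg)

lemma im_part_smult:
  "v \<in> carrier V \<Longrightarrow> im_part V (c \<odot> v) =
    complex_of_real (Re c) \<odot> im_part V v \<oplus> complex_of_real (Im c) \<odot> re_part V v"
  by (subst smult_Complex) (simp_all add: im_part_add im_part_real_smult im_part_i_smult)

lemma re_part_adj: "v \<in> carrier V \<Longrightarrow> re_part V (adj V v) = re_part V v"
  by (simp add: re_part_def adj_adj M.a_comm)

lemma im_part_adj: "v \<in> carrier V \<Longrightarrow> im_part V (adj V v) = \<ominus> im_part V v"
  using re_part_adj[of "\<i> \<odot> v"] re_part_i_smult[of v]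
  by (simp add: im_part_def adj_smult)

lemma re_part_neg: "v \<in> carrier V \<Longrightarrow> re_part V (\<ominus> v) = \<ominus> re_part V v"
  and im_part_neg: "v \<in> carrier V \<Longrightarrow> im_part V (\<ominus> v) = \<ominus> im_part V v"
  using re_part_real_smult[of v "- 1"] im_part_real_smult[of v "- 1"] by (simp_all add: neg_eq_smult)

lemma re_part_minus:
    "v \<in> carrier V \<Longrightarrow> w \<in> carrier V \<Longrightarrow> re_part V (v \<ominus> w) = re_part V v \<ominus> re_part V w"
  and im_part_minus:
    "v \<in> carrier V \<Longrightarrow> w \<in> carrier V \<Longrightarrow> im_part V (v \<ominus> w) = im_part V v \<ominus> im_part V w"
  by (simp_all add: a_minus_def re_part_add im_part_add re_part_neg im_part_neg)

lemma add_minus_cancel: "v \<in> carrier V \<Longrightarrow> w \<in> carrier V \<Longrightarrow> w \<oplus> (v \<ominus> w) = v"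
  by (simp add: a_minus_def M.a_lcomm M.r_neg)

end

section \<open>Self-adjoint subspaces as complexifications\<close>

text \<open>
  A real linear subspace of the hermitian elements.
\<close>

definition real_subspace :: "'a ostar \<Rightarrow> 'a set \<Rightarrow> bool" where
  "real_subspace V S \<longleftrightarrow> S \<subseteq> herm V \<and> \<zero>\<^bsub>V\<^esub> \<in> S \<and>
    (\<forall>v\<in>S. \<forall>w\<in>S. v \<oplus>\<^bsub>V\<^esub> w \<in> S) \<and>
    (\<forall>r. \<forall>v\<in>S. complex_of_real r \<odot>\<^bsub>V\<^esub> v \<in> S)"

text \<open>
  The complex subspace \<open>S + \<i>S\<close>, for a real subspace \<open>S\<close>, encoded by the real and imaginary
  parts of its elements.
\<close>

definition complexification :: "'a ostar \<Rightarrow> 'a set \<Rightarrow> 'a set" where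
  "complexification V S = {v \<in> carrier V. re_part V v \<in> S \<and> im_part V v \<in> S}"

context star_vectorspace
begin

lemma real_subspace_neg: "real_subspace V S \<Longrightarrow> v \<in> S \<Longrightarrow> \<ominus> v \<in> S"
  using neg_eq_smult[of v] herm_carrier unfolding real_subspace_def
  by (metis of_real_1 of_real_minus subsetD)

lemma real_subspace_minus: "real_subspace V S \<Longrightarrow> v \<in> S \<Longrightarrow> w \<in> S \<Longrightarrow> v \<ominus> w \<in> S"
  by (metis a_minus_def real_subspace_def real_subspace_neg)

lemma selfadjoint_subspaceI:
  assumes "J \<subseteq> carrier V" "\<zero> \<in> J"
    and "\<And>v w. v \<in> J \<Longrightarrow> w \<in> J \<Longrightarrow> v \<oplus> w \<in> J"
    and "\<And>c v. v \<in> J \<Longrightarrow> c \<odot> v \<in> J"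
    and adj: "\<And>v. v \<in> J \<Longrightarrow> adj V v \<in> J"
  shows "selfadjoint_subspace V J"
proof -
  have "adj V ` J = J"
  proof
    show "J \<subseteq> adj V ` J"
    proof
      fix v assume "v \<in> J"
      then show "v \<in> adj V ` J"
        using adj[of v] adj_adj[of v] assms(1) by (metis imageI subsetD)
    qed
  qed (use adj in auto)
  moreover have "VectorSpace.subspace class_ring J V"
    using assms vectorspace_axioms module_axioms
    by (auto simp: VectorSpace.subspace_def LinearCombinations.submodule_def)
  ultimately show ?thesis
    by (simp add: selfadjoint_subspace_def)
qed

lemma selfadjoint_subspaceD:
  assumes "selfadjoint_subspace V J"
  shows "J \<subseteq> carrier V" "\<zero> \<in> J"
    and "\<And>v w. v \<in> J \<Longrightarrow> w \<in> J \<Longrightarrow> v \<oplus> w \<in> J"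
    and "\<And>c v. v \<in> J \<Longrightarrow> c \<odot> v \<in> J"
    and "\<And>v. v \<in> J \<Longrightarrow> adj V v \<in> J"
proof -
  have "LinearCombinations.submodule class_ring J V"
    using assms by (simp add: selfadjoint_subspace_def VectorSpace.subspace_def)
  then show "J \<subseteq> carrier V" "\<zero> \<in> J"
    and "\<And>v w. v \<in> J \<Longrightarrow> w \<in> J \<Longrightarrow> v \<oplus> w \<in> J"
    and "\<And>c v. v \<in> J \<Longrightarrow> c \<odot> v \<in> J"
    by (simp_all add: LinearCombinations.submodule_def)
  show "\<And>v. v \<in> J \<Longrightarrow> adj V v \<in> J"
    using assms by (auto simp: selfadjoint_subspace_def)
qed

lemma selfadjoint_complexification:
  assumes S: "real_subspace V S"
  shows "selfadjoint_subspace V (complexification V S)"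
proof (rule selfadjoint_subspaceI)
  show "complexification V S \<subseteq> carrier V"
    by (auto simp: complexification_def)
  show "\<zero> \<in> complexification V S"
    using S re_part_of_herm[of \<zero>] im_part_of_herm[of \<zero>]
    by (simp add: complexification_def real_subspace_def)
next
  fix v w assume "v \<in> complexification V S" "w \<in> complexification V S"
  then show "v \<oplus> w \<in> complexification V S"
    using S by (simp add: complexification_def real_subspace_def re_part_add im_part_add)
next
  fix c v assume "v \<in> complexification V S"
  then show "c \<odot> v \<in> complexification V S"
    using S real_subspace_minus[OF S]
    by (simp add: complexification_def real_subspace_def re_part_smult im_part_smult)
next
  fix v assume "v \<in> complexification V S"
  then show "adj V v \<in> complexification V S"
    using real_subspace_neg[OF S] by (simp add: complexification_def re_part_adj im_part_adj)
qed

lemma herm_complexification_iff: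
  "real_subspace V S \<Longrightarrow> v \<in> herm V \<Longrightarrow> v \<in> complexification V S \<longleftrightarrow> v \<in> S"
  by (simp add: complexification_def re_part_of_herm im_part_of_herm real_subspace_def herm_carrier)

lemma complexification_eq_sum:
  assumes S: "real_subspace V S"
  shows "complexification V S = S <+> (\<lambda>v. \<i> \<odot> v) ` S"
proof
  show "complexification V S \<subseteq> S <+> (\<lambda>v. \<i> \<odot> v) ` S"
  proof
    fix v assume "v \<in> complexification V S"
    then have "re_part V v \<in> S" "im_part V v \<in> S" "v = re_part V v \<oplus> \<i> \<odot> im_part V v"
      using re_im_decomp by (simp_all add: complexification_def)
    then show "v \<in> S <+> (\<lambda>v. \<i> \<odot> v) ` S"
      unfolding set_add_def' by blast
  qed
next
  note D = selfadjoint_subspaceD[OF selfadjoint_complexification[OF S]]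
  have "S \<subseteq> complexification V S"
    using S herm_complexification_iff[OF S] by (auto simp: real_subspace_def)
  then show "S <+> (\<lambda>v. \<i> \<odot> v) ` S \<subseteq> complexification V S"
    unfolding set_add_def' using D(3) D(4)[of _ \<i>] by blast
qed

lemma selfadjoint_re_im:
  assumes J: "selfadjoint_subspace V J" and v: "v \<in> J"
  shows "re_part V v \<in> J" "im_part V v \<in> J"
proof -
  note D = selfadjoint_subspaceD[OF J]
  have re: "re_part V w \<in> J" if "w \<in> J" for w
    unfolding re_part_def using that D by blast
  show "re_part V v \<in> J" "im_part V v \<in> J"
    using re v D(4) by (auto simp: im_part_def)
qed

lemma selfadjoint_eq_complexification:
  assumes J: "selfadjoint_subspace V J"
  shows "J = complexification V (J \<inter> herm V)"
proof
  note D = selfadjoint_subspaceD[OF J]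
  show "J \<subseteq> complexification V (J \<inter> herm V)"
    using selfadjoint_re_im[OF J] D(1) re_part_herm im_part_herm
    by (auto simp: complexification_def)
  show "complexification V (J \<inter> herm V) \<subseteq> J"
  proof
    fix v assume "v \<in> complexification V (J \<inter> herm V)"
    then have "re_part V v \<in> J" "im_part V v \<in> J" "v = re_part V v \<oplus> \<i> \<odot> im_part V v"
      using re_im_decomp by (simp_all add: complexification_def)
    then show "v \<in> J"
      using D(3) D(4)[of _ \<i>] by metis
  qed
qed

end

section \<open>Quotients by self-adjoint subspaces\<close>

text \<open>
  The quotient by a self-adjoint subspace \<open>J\<close>. The cone representatives \<open>C\<close> of
  \<open>quot_space V J C\<close> are arbitrary: they are irrelevant for the linear structure and the involution.
\<close>

locale star_quotient = star_vectorspace +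
  fixes J
  assumes J: "selfadjoint_subspace V J"
begin

lemmas J_carrier = selfadjoint_subspaceD(1)[OF J]
  and J_zero [simp] = selfadjoint_subspaceD(2)[OF J]
  and J_add = selfadjoint_subspaceD(3)[OF J]
  and J_smult = selfadjoint_subspaceD(4)[OF J]
  and J_adj = selfadjoint_subspaceD(5)[OF J]

lemma J_in_carrier: "v \<in> J \<Longrightarrow> v \<in> carrier V"
  using J_carrier by blast

lemma J_neg: "v \<in> J \<Longrightarrow> \<ominus> v \<in> J"
  using J_smult neg_eq_smult J_in_carrier by simp

lemma coset_eqI:
  assumes "v \<in> carrier V" "w \<in> carrier V" "v \<ominus> w \<in> J"
  shows "J +> v = J +> w"
proof -
  have *: "J +> v \<subseteq> J +> w" if "v \<in> carrier V" "w \<in> carrier V" "v \<ominus> w \<in> J" for v w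
  proof
    fix x assume "x \<in> J +> v"
    then obtain j where j: "j \<in> J" "x = j \<oplus> v"
      by (auto simp: a_r_coset_def')
    then have "x = (j \<oplus> (v \<ominus> w)) \<oplus> w"
      using that J_in_carrier[of j] by (simp add: a_minus_def M.a_assoc M.l_neg)
    then show "x \<in> J +> w"
      using j that J_add by (auto simp: a_r_coset_def')
  qed
  have "w \<ominus> v = \<ominus> (v \<ominus> w)"
    using assms by (simp add: a_minus_def M.minus_add M.a_comm)
  then have "w \<ominus> v \<in> J"
    using J_neg assms(3) by simp
  then show ?thesis
    using *[of v w] *[of w v] assms by blast
qed

lemma coset_self: "v \<in> carrier V \<Longrightarrow> v \<in> J +> v"
  using M.l_zero[of v] J_zero unfolding a_r_coset_def' by (metis UN_iff singletonI)

lemma coset_memD: "v \<in> carrier V \<Longrightarrow> x \<in> J +> v \<Longrightarrow> x \<in> carrier V \<and> x \<ominus> v \<in> J"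
  using J_in_carrier by (auto simp: a_r_coset_def' a_minus_def M.a_assoc M.r_neg)

lemma coset_eq_iff:
  assumes "v \<in> carrier V" "w \<in> carrier V"
  shows "J +> v = J +> w \<longleftrightarrow> v \<ominus> w \<in> J"
proof
  assume "J +> v = J +> w"
  then have "v \<in> J +> w"
    using coset_self[OF assms(1)] by simp
  then show "v \<ominus> w \<in> J"
    using coset_memD[OF assms(2)] by simp
qed (rule coset_eqI[OF assms])

lemma coset_zero: "J +> \<zero> = J"
proof -
  have "(\<Union>h\<in>J. {h \<oplus> \<zero>}) = (\<Union>h\<in>J. {h})"
    using J_in_carrier by (intro SUP_cong) simp_all
  then show ?thesis
    by (simp add: a_r_coset_def')
qed

lemma coset_eq_J_iff: "v \<in> carrier V \<Longrightarrow> J +> v = J \<longleftrightarrow> v \<in> J"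
  using coset_eq_iff[of v \<zero>] coset_zero by (simp add: a_minus_def)

lemma quot_carrier: "carrier (quot_space V J C) = (\<lambda>v. J +> v) ` carrier V"
  by (auto simp: quot_space_def A_RCOSETS_def')

lemma coset_in_quot: "v \<in> carrier V \<Longrightarrow> J +> v \<in> carrier (quot_space V J C)"
  by (simp add: quot_carrier)

lemma quot_zero: "\<zero>\<^bsub>quot_space V J C\<^esub> = J +> \<zero>"
  by (simp add: coset_zero) (simp add: quot_space_def)

lemma quot_add:
  assumes "v \<in> carrier V" "w \<in> carrier V"
  shows "(J +> v) \<oplus>\<^bsub>quot_space V J C\<^esub> (J +> w) = J +> (v \<oplus> w)"
proof -
  have "subgroup J (add_monoid V)"
    using J_in_carrier J_add J_neg
    by (intro subgroup.intro) (auto simp flip: a_inv_def)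
  then have "abelian_subgroup J V"
    by (intro abelian_subgroupI3 additive_subgroup.intro M.abelian_group_axioms)
  then show ?thesis
    using assms by (simp add: quot_space_def abelian_subgroup.a_rcos_sum)
qed

lemma quot_smult:
  assumes v: "v \<in> carrier V"
  shows "c \<odot>\<^bsub>quot_space V J C\<^esub> (J +> v) = J +> (c \<odot> v)"
proof -
  have "J +> (c \<odot> x) = J +> (c \<odot> v)" if "x \<in> J +> v" for x
  proof (rule coset_eqI)
    have x: "x \<in> carrier V" "x \<ominus> v \<in> J"
      using coset_memD[OF v that] by auto
    have "c \<odot> x \<ominus> c \<odot> v = c \<odot> (x \<ominus> v)"
      using v x by (simp add: a_minus_def smult_add_right smult_neg)
    then show "c \<odot> x \<ominus> c \<odot> v \<in> J"
      using J_smult x by simp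
    show "c \<odot> x \<in> carrier V" "c \<odot> v \<in> carrier V"
      using x v by auto
  qed
  then have "(\<Union>x\<in>J +> v. J +> (c \<odot> x)) = (\<Union>x\<in>J +> v. J +> (c \<odot> v))"
    by (rule SUP_cong[OF refl])
  then show ?thesis
    using coset_self[OF v] by (auto simp: quot_space_def)
qed

lemma quot_adj:
  assumes v: "v \<in> carrier V"
  shows "adj (quot_space V J C) (J +> v) = J +> adj V v"
proof -
  have "J +> adj V x = J +> adj V v" if "x \<in> J +> v" for x
  proof (rule coset_eqI)
    have x: "x \<in> carrier V" "x \<ominus> v \<in> J"
      using coset_memD[OF v that] by auto
    have "adj V x \<ominus> adj V v = adj V (x \<ominus> v)"
      using v x by (simp add: a_minus_def adj_add adj_neg)
    then show "adj V x \<ominus> adj V v \<in> J"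
      using J_adj x by simp
    show "adj V x \<in> carrier V" "adj V v \<in> carrier V"
      using x v by auto
  qed
  then have "(\<Union>x\<in>J +> v. J +> adj V x) = (\<Union>x\<in>J +> v. J +> adj V v)"
    by (rule SUP_cong[OF refl])
  then show ?thesis
    using coset_self[OF v] by (auto simp: quot_space_def)
qed

lemmas quot_simps = quot_carrier quot_zero quot_add quot_smult quot_adj

lemma quot_abelian_group: "abelian_group (quot_space V J C)"
proof (rule abelian_groupI)
  fix X assume "X \<in> carrier (quot_space V J C)"
  then obtain v where v: "v \<in> carrier V" "X = J +> v"
    by (auto simp: quot_carrier)
  show "\<exists>Y\<in>carrier (quot_space V J C).
      Y \<oplus>\<^bsub>quot_space V J C\<^esub> X = \<zero>\<^bsub>quot_space V J C\<^esub>"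
    using v by (intro bexI[of _ "J +> \<ominus> v"]) (auto simp: quot_simps M.l_neg)
next
  fix X Y assume "X \<in> carrier (quot_space V J C)" "Y \<in> carrier (quot_space V J C)"
  then show "X \<oplus>\<^bsub>quot_space V J C\<^esub> Y = Y \<oplus>\<^bsub>quot_space V J C\<^esub> X"
    using M.a_comm by (auto simp: quot_simps)
qed (auto simp: quot_simps M.a_assoc)

lemma quot_star_vectorspace: "star_vectorspace (quot_space V J C)"
proof -
  let ?W = "quot_space V J C"
  have "module class_ring ?W"
    by (rule moduleI[OF _ quot_abelian_group])
      (auto simp: quot_simps smult_add_left smult_add_right smult_smult class_cring.is_cring)
  then have "vectorspace class_ring ?W"
    by (intro vectorspace.intro class_field)
  moreover have "star_vectorspace_axioms ?W"
    by unfold_locales (auto simp: quot_simps adj_add adj_smult adj_adj)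
  ultimately show ?thesis
    by (rule star_vectorspace.intro)
qed

lemma quot_neg:
  "v \<in> carrier V \<Longrightarrow> \<ominus>\<^bsub>quot_space V J C\<^esub> (J +> v) = J +> \<ominus> v"
  using star_vectorspace.neg_eq_smult[OF quot_star_vectorspace[of C] coset_in_quot]
  by (simp add: quot_smult neg_eq_smult)

lemma quot_minus:
  "v \<in> carrier V \<Longrightarrow> w \<in> carrier V \<Longrightarrow>
    (J +> v) \<ominus>\<^bsub>quot_space V J C\<^esub> (J +> w) = J +> (v \<ominus> w)"
  by (simp add: a_minus_def quot_neg quot_add)

lemma quot_re_part:
  "v \<in> carrier V \<Longrightarrow> re_part (quot_space V J C) (J +> v) = J +> re_part V v"
  by (simp add: re_part_def quot_simps)

lemma quot_im_part:
  "v \<in> carrier V \<Longrightarrow> im_part (quot_space V J C) (J +> v) = J +> im_part V v"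
  by (simp add: im_part_def quot_simps quot_re_part)

text \<open>
  Every hermitian coset has a hermitian representative, namely the real part of any representative.
\<close>

lemma quot_herm: "herm (quot_space V J C) = (\<lambda>v. J +> v) ` herm V"
proof
  show "(\<lambda>v. J +> v) ` herm V \<subseteq> herm (quot_space V J C)"
    by (auto simp: herm_def quot_simps)
next
  show "herm (quot_space V J C) \<subseteq> (\<lambda>v. J +> v) ` herm V"
  proof
    fix X assume X: "X \<in> herm (quot_space V J C)"
    then obtain v where v: "v \<in> carrier V" "X = J +> v"
      by (auto simp: herm_def quot_carrier)
    have "X = J +> re_part V v"
      using star_vectorspace.re_part_of_herm[OF quot_star_vectorspace X] v
      by (simp add: quot_re_part)
    then show "X \<in> (\<lambda>v. J +> v) ` herm V"
      using re_part_herm v by auto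
  qed
qed

lemma quot_cone: "cone (quot_space V J C) = (\<lambda>v. J +> v) ` C"
  by (simp add: quot_space_def)

lemma coset_module_hom:
  "(\<lambda>v. J +> v) \<in> LinearCombinations.module_hom class_ring V (quot_space V J C)"
  by (auto simp: LinearCombinations.module_hom_def quot_simps)

end

section \<open>Wedges of hermitian elements\<close>

text \<open>
  A convex cone of hermitian elements that contains \<open>0\<close> but need not be proper.
\<close>

definition wedge :: "'a ostar \<Rightarrow> 'a set \<Rightarrow> bool" where
  "wedge V P \<longleftrightarrow> P \<subseteq> herm V \<and> \<zero>\<^bsub>V\<^esub> \<in> P \<and>
    (\<forall>v\<in>P. \<forall>w\<in>P. v \<oplus>\<^bsub>V\<^esub> w \<in> P) \<and>
    (\<forall>r\<ge>0. \<forall>v\<in>P. complex_of_real r \<odot>\<^bsub>V\<^esub> v \<in> P)"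

text \<open>
  The largest real subspace contained in the wedge \<open>P\<close>.
\<close>

definition lineality :: "'a ostar \<Rightarrow> 'a set \<Rightarrow> 'a set" where
  "lineality V P = {v \<in> P. \<ominus>\<^bsub>V\<^esub> v \<in> P}"

text \<open>
  The hermitian elements to which adding any positive multiple of \<open>u\<close>, however small, gives an
  element of \<open>P\<close>. For \<open>P = cone V\<close> this is \<open>arch_cone V u\<close>.
\<close>

definition arch_closure :: "'a ostar \<Rightarrow> 'a \<Rightarrow> 'a set \<Rightarrow> 'a set" where
  "arch_closure V u P = {v \<in> herm V. \<forall>r>0. complex_of_real r \<odot>\<^bsub>V\<^esub> u \<oplus>\<^bsub>V\<^esub> v \<in> P}"

text \<open>
  The wedge generated by the wedge \<open>P\<close> and a hermitian element \<open>x\<close>.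
\<close>

definition adjoin :: "'a ostar \<Rightarrow> 'a set \<Rightarrow> 'a \<Rightarrow> 'a set" where
  "adjoin V P x = {p \<oplus>\<^bsub>V\<^esub> complex_of_real t \<odot>\<^bsub>V\<^esub> x | p t. p \<in> P \<and> t \<ge> 0}"

text \<open>
  The real number \<open>s\<close> separates the multiples of \<open>u\<close> above \<open>x\<close> from those below \<open>x\<close>, in the
  preorder with positive wedge \<open>P\<close>.
\<close>

definition cut_value :: "'a ostar \<Rightarrow> 'a \<Rightarrow> 'a set \<Rightarrow> 'a \<Rightarrow> real \<Rightarrow> bool" where
  "cut_value V u P x s \<longleftrightarrow>
    (\<forall>t>s. complex_of_real t \<odot>\<^bsub>V\<^esub> u \<ominus>\<^bsub>V\<^esub> x \<in> P) \<and>
    (\<forall>t<s. x \<ominus>\<^bsub>V\<^esub> complex_of_real t \<odot>\<^bsub>V\<^esub> u \<in> P)"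

context star_vectorspace
begin

lemma wedgeD:
  assumes "wedge V P"
  shows "P \<subseteq> herm V" "\<zero> \<in> P" "\<And>v w. v \<in> P \<Longrightarrow> w \<in> P \<Longrightarrow> v \<oplus> w \<in> P"
    and "\<And>r v. v \<in> P \<Longrightarrow> r \<ge> 0 \<Longrightarrow> complex_of_real r \<odot> v \<in> P"
    and "\<And>v. v \<in> P \<Longrightarrow> v \<in> carrier V"
  using assms herm_carrier by (auto simp: wedge_def)

lemma minus_add_minus:
  assumes "a \<in> carrier V" "x \<in> carrier V" "b \<in> carrier V"
  shows "(a \<ominus> x) \<oplus> (x \<ominus> b) = a \<ominus> b"
  using assms by (simp add: a_minus_def M.a_assoc M.r_neg1)

lemma minus_minus_eq:
  assumes "a \<in> carrier V" "x \<in> carrier V"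
  shows "\<ominus> (a \<ominus> x) = x \<ominus> a"
  using assms by (simp add: a_minus_def M.minus_add M.a_comm)

lemma real_subspace_lineality:
  assumes P: "wedge V P"
  shows "real_subspace V (lineality V P)"
  unfolding real_subspace_def
proof (intro conjI ballI allI)
  note D = wedgeD[OF P]
  show "lineality V P \<subseteq> herm V" "\<zero> \<in> lineality V P"
    using D by (auto simp: lineality_def)
  fix v assume v: "v \<in> lineality V P"
  then show "v \<oplus> w \<in> lineality V P" if "w \<in> lineality V P" for w
    using that D by (auto simp: lineality_def M.minus_add)
  show "complex_of_real r \<odot> v \<in> lineality V P" for r
  proof (cases "r \<ge> 0")
    case True
    then show ?thesis
      using v D(4)[of _ r] D(5) by (auto simp: lineality_def simp flip: smult_neg)
  next
    case False
    then have "complex_of_real (- r) \<odot> v \<in> P" "complex_of_real (- r) \<odot> (\<ominus> v) \<in> P"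
      using v D(4)[of _ "- r"] by (auto simp: lineality_def)
    then show ?thesis
      using v D(5)[of v] by (simp add: lineality_def neg_eq_smult smult_smult)
  qed
qed

lemma wedge_adjoin:
  assumes P: "wedge V P" and x: "x \<in> herm V"
  shows "wedge V (adjoin V P x)" "P \<subseteq> adjoin V P x" "x \<in> adjoin V P x"
proof -
  note D = wedgeD[OF P]
  have xc: "x \<in> carrier V"
    using x by (rule herm_carrier)
  show "wedge V (adjoin V P x)"
    unfolding wedge_def
  proof (intro conjI ballI allI impI)
    show "adjoin V P x \<subseteq> herm V"
      using D(1) x herm_add herm_smult by (auto simp: adjoin_def)
    have "\<zero> = \<zero> \<oplus> complex_of_real 0 \<odot> x"
      using xc by simp
    then show "\<zero> \<in> adjoin V P x"
      unfolding adjoin_def using D(2) by blast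
  next
    fix v w assume "v \<in> adjoin V P x" "w \<in> adjoin V P x"
    then obtain p t q s where *: "p \<in> P" "q \<in> P" "t \<ge> 0" "s \<ge> 0"
      "v = p \<oplus> complex_of_real t \<odot> x" "w = q \<oplus> complex_of_real s \<odot> x"
      by (auto simp: adjoin_def)
    then have "v \<oplus> w = (p \<oplus> q) \<oplus> complex_of_real (t + s) \<odot> x"
      using xc D(5)[of p] D(5)[of q] by (simp add: smult_add_left M.a_ac)
    moreover have "p \<oplus> q \<in> P" "t + s \<ge> 0"
      using * D(3) by auto
    ultimately show "v \<oplus> w \<in> adjoin V P x"
      unfolding adjoin_def by blast
  next
    fix r :: real and v assume "r \<ge> 0" "v \<in> adjoin V P x"
    then obtain p t where *: "p \<in> P" "t \<ge> 0" "r \<ge> 0" "v = p \<oplus> complex_of_real t \<odot> x"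
      by (auto simp: adjoin_def)
    then have "complex_of_real r \<odot> v =
        complex_of_real r \<odot> p \<oplus> complex_of_real (r * t) \<odot> x"
      using xc D(5)[of p] by (simp add: smult_add_right smult_smult)
    moreover have "complex_of_real r \<odot> p \<in> P" "r * t \<ge> 0"
      using * D(4) by auto
    ultimately show "complex_of_real r \<odot> v \<in> adjoin V P x"
      unfolding adjoin_def by blast
  qed
  show "P \<subseteq> adjoin V P x"
  proof
    fix p assume "p \<in> P"
    moreover then have "p = p \<oplus> complex_of_real 0 \<odot> x"
      using xc D(5)[of p] by simp
    ultimately show "p \<in> adjoin V P x"
      unfolding adjoin_def by blast
  qed
  have "x = \<zero> \<oplus> complex_of_real 1 \<odot> x"
    using xc by simp
  then show "x \<in> adjoin V P x"
    unfolding adjoin_def using D(2) zero_le_one by blast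
qed

text \<open>
  If adjoining \<open>x\<close> puts \<open>-u\<close> into the wedge, then \<open>-u = p + t x\<close> with \<open>t > 0\<close>, and therefore
  \<open>-x = (p + u)/t\<close> was there already.
\<close>

lemma neg_in_wedge_if_adjoin:
  assumes P: "wedge V P" and x: "x \<in> herm V" and u: "u \<in> P" "\<ominus> u \<notin> P"
    and adj: "\<ominus> u \<in> adjoin V P x"
  shows "\<ominus> x \<in> P"
proof -
  note D = wedgeD[OF P]
  have xc: "x \<in> carrier V" and uc: "u \<in> carrier V"
    using x herm_carrier u D(5) by auto
  obtain p t where p: "p \<in> P" "t \<ge> 0" "\<ominus> u = p \<oplus> complex_of_real t \<odot> x"
    using adj by (auto simp: adjoin_def)
  have pc: "p \<in> carrier V"
    using p D(5) by simp
  have "t \<noteq> 0"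
    using p u xc pc by auto
  have "(p \<oplus> complex_of_real t \<odot> x) \<oplus> u = \<zero>"
    using p(3) uc by (metis M.l_neg)
  then have "(p \<oplus> u) \<oplus> complex_of_real t \<odot> x = \<zero>"
    using pc uc xc by (simp add: M.a_ac)
  then have "\<ominus> (complex_of_real t \<odot> x) = p \<oplus> u"
    using pc uc xc by (simp add: M.minus_equality)
  then have "complex_of_real (1 / t) \<odot> (\<ominus> (complex_of_real t \<odot> x)) \<in> P"
    using D(3,4) p(1,2) u(1) by (simp del: of_real_divide)
  then show ?thesis
    using \<open>t \<noteq> 0\<close> xc by (simp add: smult_neg smult_smult)
qed

text \<open>
  A wedge that is maximal among those avoiding \<open>-u\<close> makes all hermitian elements comparable.
\<close>

lemma maximal_wedge:
  assumes P: "wedge V P" and u: "u \<in> P" "\<ominus> u \<notin> P"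
  obtains M where "wedge V M" "P \<subseteq> M" "\<ominus> u \<notin> M"
    and "\<And>x. x \<in> herm V \<Longrightarrow> x \<in> M \<or> \<ominus> x \<in> M"
proof -
  let ?A = "{M. wedge V M \<and> P \<subseteq> M \<and> \<ominus> u \<notin> M}"
  have "\<exists>M\<in>?A. \<forall>X\<in>?A. M \<subseteq> X \<longrightarrow> X = M"
  proof (rule subset_Zorn_nonempty)
    show "?A \<noteq> {}"
      using P u by blast
  next
    fix C assume "C \<noteq> {}" and "subset.chain ?A C"
    then have wedge: "\<And>M. M \<in> C \<Longrightarrow> wedge V M" and sub: "\<And>M. M \<in> C \<Longrightarrow> P \<subseteq> M"
      and u: "\<And>M. M \<in> C \<Longrightarrow> \<ominus> u \<notin> M"
      and chain: "\<And>X Y. X \<in> C \<Longrightarrow> Y \<in> C \<Longrightarrow> X \<subseteq> Y \<or> Y \<subseteq> X"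
      by (auto simp: subset_chain_def)
    have "wedge V (\<Union>C)"
      unfolding wedge_def
    proof (intro conjI ballI allI impI)
      show "\<Union>C \<subseteq> herm V" "\<zero> \<in> \<Union>C"
        using wedgeD(1,2)[OF wedge] \<open>C \<noteq> {}\<close> by auto
    next
      fix v w assume "v \<in> \<Union>C" "w \<in> \<Union>C"
      then obtain X Y where "X \<in> C" "Y \<in> C" "v \<in> X" "w \<in> Y"
        by blast
      then obtain Z where "Z \<in> C" "v \<in> Z" "w \<in> Z"
        using chain by blast
      then show "v \<oplus> w \<in> \<Union>C"
        using wedgeD(3)[OF wedge] by blast
    next
      fix r :: real and v assume "r \<ge> 0" "v \<in> \<Union>C"
      then show "complex_of_real r \<odot> v \<in> \<Union>C"
        using wedgeD(4)[OF wedge] by blast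
    qed
    then show "\<Union>C \<in> ?A"
      using sub u \<open>C \<noteq> {}\<close> by blast
  qed
  then obtain M where M: "wedge V M" "P \<subseteq> M" "\<ominus> u \<notin> M"
    and max: "\<And>X. wedge V X \<Longrightarrow> P \<subseteq> X \<Longrightarrow> \<ominus> u \<notin> X \<Longrightarrow> M \<subseteq> X \<Longrightarrow> X = M"
    by auto
  have "x \<in> M \<or> \<ominus> x \<in> M" if x: "x \<in> herm V" for x
  proof (cases "\<ominus> u \<in> adjoin V M x")
    case True
    then show ?thesis
      using neg_in_wedge_if_adjoin[OF M(1) x _ M(3)] u M(2) by blast
  next
    case False
    then have "adjoin V M x = M"
      using max wedge_adjoin[OF M(1) x] M(2) by blast
    then show ?thesis
      using wedge_adjoin(3)[OF M(1) x] by simp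
  qed
  with M that show thesis
    by blast
qed

lemma wedge_arch_closure:
  assumes Q: "wedge V Q" and u: "u \<in> Q"
  shows "wedge V (arch_closure V u Q)"
  unfolding wedge_def
proof (intro conjI ballI allI impI)
  note D = wedgeD[OF Q]
  have [simp]: "u \<in> carrier V"
    using D(5) u by simp
  show "arch_closure V u Q \<subseteq> herm V"
    by (auto simp: arch_closure_def)
  show "\<zero> \<in> arch_closure V u Q"
    using D(4)[OF u] by (auto simp: arch_closure_def)
  fix v assume v: "v \<in> arch_closure V u Q"
  have "complex_of_real r \<odot> u \<oplus> (v \<oplus> w) \<in> Q" if w: "w \<in> arch_closure V u Q" and "r > 0" for w r
  proof -
    note * = v w
    have "(complex_of_real (r / 2) \<odot> u \<oplus> v) \<oplus> (complex_of_real (r / 2) \<odot> u \<oplus> w) \<in> Q"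
      (is "?z \<in> _")
      by (rule D(3)) (use * that in \<open>auto simp: arch_closure_def simp del: of_real_divide\<close>)
    also have "?z = complex_of_real (r / 2 + r / 2) \<odot> u \<oplus> (v \<oplus> w)"
      unfolding of_real_add using * herm_carrier
      by (subst smult_add_left) (simp_all add: arch_closure_def M.a_ac del: of_real_divide)
    finally show ?thesis
      by simp
  qed
  then show "v \<oplus> w \<in> arch_closure V u Q" if "w \<in> arch_closure V u Q" for w
    using v that by (simp add: arch_closure_def herm_add)
  fix r :: real assume r: "r \<ge> 0"
  have vh: "v \<in> herm V"
    using v by (simp add: arch_closure_def)
  have vc: "v \<in> carrier V"
    using vh by (rule herm_carrier)
  have "complex_of_real s \<odot> u \<oplus> complex_of_real r \<odot> v \<in> Q" if "s > 0" for s
  proof (cases "r = 0")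
    case True
    then show ?thesis
      using vc that D(4)[OF u, of s] by simp
  next
    case False
    then have "complex_of_real r \<odot> (complex_of_real (s / r) \<odot> u \<oplus> v) \<in> Q"
      using v r that by (intro D(4)) (auto simp: arch_closure_def simp del: of_real_divide)
    then show ?thesis
      using vc False by (simp add: smult_add_right smult_smult)
  qed
  then show "complex_of_real r \<odot> v \<in> arch_closure V u Q"
    using vh by (simp add: arch_closure_def herm_smult)
qed

lemma arch_cone_eq_arch_closure: "arch_cone V u = arch_closure V u (cone V)"
  by (simp add: arch_cone_def arch_closure_def)

lemma subset_arch_closure:
  assumes Q: "wedge V Q" and u: "u \<in> Q"
  shows "Q \<subseteq> arch_closure V u Q"
  using wedgeD(1,3)[OF Q] wedgeD(4)[OF Q u] by (auto simp: arch_closure_def)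

text \<open>
  The Archimedean closure is a closure: applying it a second time adds nothing, as \<open>r = r/2 + r/2\<close>.
\<close>

lemma arch_closure_closed:
  assumes u: "u \<in> herm V" and x: "x \<in> herm V"
    and *: "\<And>r. r > 0 \<Longrightarrow> complex_of_real r \<odot> u \<oplus> x \<in> arch_closure V u Q"
  shows "x \<in> arch_closure V u Q"
proof -
  have [simp]: "u \<in> carrier V" "x \<in> carrier V"
    using u x herm_carrier by auto
  have "complex_of_real r \<odot> u \<oplus> x \<in> Q" if "r > 0" for r
  proof -
    have "complex_of_real (r / 2) \<odot> u \<oplus> (complex_of_real (r / 2) \<odot> u \<oplus> x) \<in> Q"
      (is "?z \<in> _")
      using *[of "r / 2"] that by (simp add: arch_closure_def del: of_real_divide)
    also have "?z = complex_of_real (r / 2 + r / 2) \<odot> u \<oplus> x"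
      unfolding of_real_add by (subst smult_add_left) (simp_all add: M.a_assoc del: of_real_divide)
    finally show ?thesis
      by simp
  qed
  then show ?thesis
    using x by (simp add: arch_closure_def)
qed

end

section \<open>The state of a total wedge\<close>

text \<open>
  A total preorder on the hermitian elements, given by its positive wedge \<open>P\<close>, in which \<open>u\<close> bounds
  every element and \<open>-u\<close> is not positive. The position of a hermitian element relative to the
  multiples of \<open>u\<close> is then a real linear functional.
\<close>

locale total_wedge = star_vectorspace +
  fixes u P
  assumes P: "wedge V P"
    and u: "u \<in> P" "\<ominus> u \<notin> P"
    and total: "x \<in> herm V \<Longrightarrow> x \<in> P \<or> \<ominus> x \<in> P"
    and bounded: "x \<in> herm V \<Longrightarrow> \<exists>r. complex_of_real r \<odot> u \<ominus> x \<in> P"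
begin

lemmas P_herm = wedgeD(1)[OF P] and P_add = wedgeD(3)[OF P]
  and P_smult = wedgeD(4)[OF P] and P_carrier = wedgeD(5)[OF P]

lemma u_herm: "u \<in> herm V" and u_carrier [simp]: "u \<in> carrier V"
  using u P_herm herm_carrier by auto

lemma smult_u_in_P_iff: "complex_of_real t \<odot> u \<in> P \<longleftrightarrow> t \<ge> 0"
proof
  assume *: "complex_of_real t \<odot> u \<in> P"
  show "t \<ge> 0"
  proof (rule ccontr)
    assume t: "\<not> t \<ge> 0"
    then have "complex_of_real (- 1 / t) \<odot> (complex_of_real t \<odot> u) \<in> P"
      by (intro P_smult *) simp
    then have "\<ominus> u \<in> P"
      using t by (simp add: smult_smult neg_eq_smult)
    with u show False
      by simp
  qed
qed (use u P_smult in auto)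

lemma P_up_closed:
  assumes x: "x \<in> herm V" and "complex_of_real s \<odot> u \<ominus> x \<in> P" "s \<le> t"
  shows "complex_of_real t \<odot> u \<ominus> x \<in> P"
proof -
  have "complex_of_real (t - s) \<odot> u \<oplus> (complex_of_real s \<odot> u \<ominus> x) \<in> P"
    using assms by (intro P_add) (simp_all add: smult_u_in_P_iff del: of_real_diff)
  also have "complex_of_real (t - s) \<odot> u \<oplus> (complex_of_real s \<odot> u \<ominus> x) =
      (complex_of_real (t - s) \<odot> u \<oplus> complex_of_real s \<odot> u) \<ominus> x"
    using herm_carrier[OF x] by (simp add: a_minus_def M.a_assoc)
  also have "complex_of_real (t - s) \<odot> u \<oplus> complex_of_real s \<odot> u = complex_of_real t \<odot> u"
    by (simp flip: smult_add_left)
  finally show ?thesis .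
qed

lemma cut_le:
  assumes x: "x \<in> herm V" and "x \<ominus> complex_of_real s \<odot> u \<in> P"
    and "complex_of_real t \<odot> u \<ominus> x \<in> P"
  shows "s \<le> t"
proof -
  have "(complex_of_real t \<odot> u \<ominus> x) \<oplus> (x \<ominus> complex_of_real s \<odot> u) \<in> P"
    using assms by (intro P_add)
  also have "(complex_of_real t \<odot> u \<ominus> x) \<oplus> (x \<ominus> complex_of_real s \<odot> u) =
      complex_of_real (t - s) \<odot> u"
    using herm_carrier[OF x] smult_add_left[of u "complex_of_real t" "- complex_of_real s"]
    by (simp add: minus_add_minus) (simp add: minus_eq_smult smult_smult)
  finally show ?thesis
    by (simp add: smult_u_in_P_iff del: of_real_diff)
qed

lemma ex_cut_value:
  assumes x: "x \<in> herm V"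
  shows "\<exists>s. cut_value V u P x s"
proof -
  let ?T = "{t. complex_of_real t \<odot> u \<ominus> x \<in> P}"
  have xc: "x \<in> carrier V"
    using x by (rule herm_carrier)
  obtain r where r: "complex_of_real r \<odot> u \<ominus> (\<ominus> x) \<in> P"
    using bounded[OF herm_neg[OF x]] by blast
  have "complex_of_real r \<odot> u \<ominus> (\<ominus> x) = x \<ominus> complex_of_real (- r) \<odot> u"
    using xc by (simp add: minus_eq_smult neg_eq_smult smult_smult M.a_comm)
  then have "\<And>t. t \<in> ?T \<Longrightarrow> - r \<le> t"
    using cut_le[OF x, of "- r"] r by simp
  then have bdd: "bdd_below ?T"
    by (rule bdd_belowI)
  have ne: "?T \<noteq> {}"
    using bounded[OF x] by blast
  have "complex_of_real t \<odot> u \<ominus> x \<in> P" if "Inf ?T < t" for t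
    using that P_up_closed[OF x] cInf_less_iff[OF ne bdd] by (auto intro: less_imp_le)
  moreover have "x \<ominus> complex_of_real t \<odot> u \<in> P" if "t < Inf ?T" for t
  proof -
    have "t \<notin> ?T"
      using that cInf_lower[OF _ bdd] by fastforce
    moreover have "complex_of_real t \<odot> u \<ominus> x \<in> herm V"
      using x u_herm by (intro herm_minus herm_smult)
    ultimately have "\<ominus> (complex_of_real t \<odot> u \<ominus> x) \<in> P"
      using total by blast
    then show ?thesis
      using xc by (simp add: minus_minus_eq)
  qed
  ultimately show ?thesis
    unfolding cut_value_def by blast
qed

lemma cut_value_unique:
  assumes x: "x \<in> herm V" and "cut_value V u P x s" "cut_value V u P x s'"
  shows "s = s'"
proof -
  have *: "\<not> s < s'" if "cut_value V u P x s" "cut_value V u P x s'" for s s'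
  proof
    assume "s < s'"
    \<comment> \<open>two separated points between the two cut values\<close>
    define a b where "a = s + (s' - s) / 3" and "b = s + 2 * (s' - s) / 3"
    have ab: "s < a" "a < b" "b < s'"
      using \<open>s < s'\<close> by (simp_all add: a_def b_def field_simps)
    then have "b \<le> a"
      using that x by (intro cut_le) (auto simp: cut_value_def)
    with ab show False
      by simp
  qed
  show ?thesis
    using *[of s s'] *[of s' s] assms by simp
qed

text \<open>
  The cut value, which is unique for hermitian \<open>x\<close>; it equals \<open>Inf {t. t u - x \<in> P}\<close>.
\<close>

definition val :: "'a \<Rightarrow> real" where
  "val x = (THE s. cut_value V u P x s)"

lemma val_eqI: "x \<in> herm V \<Longrightarrow> cut_value V u P x s \<Longrightarrow> val x = s"
  using cut_value_unique unfolding val_def by blast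

lemma cut_value_val: "x \<in> herm V \<Longrightarrow> cut_value V u P x (val x)"
  using ex_cut_value val_eqI by metis

lemma val_add:
  assumes x: "x \<in> herm V" and y: "y \<in> herm V"
  shows "val (x \<oplus> y) = val x + val y"
proof (rule val_eqI[OF herm_add[OF x y]])
  have xc: "x \<in> carrier V" "y \<in> carrier V"
    using x y herm_carrier by auto
  have "complex_of_real t \<odot> u \<ominus> (x \<oplus> y) \<in> P" if "t > val x + val y" for t
  proof -
    \<comment> \<open>split \<open>t\<close> as \<open>a + (t - a)\<close>, sharing the excess over \<open>val x + val y\<close> equally\<close>
    define a where "a = (t + val x - val y) / 2"
    have a: "a > val x" "t - a > val y"
      using that by (simp_all add: a_def field_simps)
    then have "(complex_of_real a \<odot> u \<ominus> x) \<oplus> (complex_of_real (t - a) \<odot> u \<ominus> y) \<in> P"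
      (is "?z \<in> P")
      using cut_value_val[OF x] cut_value_val[OF y]
      by (intro P_add) (auto simp: cut_value_def simp del: of_real_diff)
    also have "?z = complex_of_real (a + (t - a)) \<odot> u \<ominus> (x \<oplus> y)"
      unfolding of_real_add using xc by (simp add: vs_simps del: of_real_diff)
    finally show ?thesis
      by simp
  qed
  moreover have "(x \<oplus> y) \<ominus> complex_of_real t \<odot> u \<in> P" if "t < val x + val y" for t
  proof -
    define a where "a = (t + val x - val y) / 2"
    have a: "a < val x" "t - a < val y"
      using that by (simp_all add: a_def field_simps)
    then have "(x \<ominus> complex_of_real a \<odot> u) \<oplus> (y \<ominus> complex_of_real (t - a) \<odot> u) \<in> P"
      (is "?z \<in> P")
      using cut_value_val[OF x] cut_value_val[OF y]
      by (intro P_add) (auto simp: cut_value_def simp del: of_real_diff)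
    also have "?z = (x \<oplus> y) \<ominus> complex_of_real (a + (t - a)) \<odot> u"
      unfolding of_real_add using xc by (simp add: vs_simps del: of_real_diff)
    finally show ?thesis
      by simp
  qed
  ultimately show "cut_value V u P (x \<oplus> y) (val x + val y)"
    by (simp add: cut_value_def)
qed

lemma val_neg:
  assumes x: "x \<in> herm V"
  shows "val (\<ominus> x) = - val x"
proof (rule val_eqI[OF herm_neg[OF x]])
  have xc: "x \<in> carrier V"
    using x by (rule herm_carrier)
  have "complex_of_real t \<odot> u \<ominus> (\<ominus> x) = x \<ominus> complex_of_real (- t) \<odot> u"
    "\<ominus> x \<ominus> complex_of_real t \<odot> u = complex_of_real (- t) \<odot> u \<ominus> x" for t
    using xc by (simp_all add: minus_eq_smult neg_eq_smult smult_smult M.a_comm)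
  then show "cut_value V u P (\<ominus> x) (- val x)"
    using cut_value_val[OF x] by (auto simp: cut_value_def simp del: of_real_minus)
qed

lemma val_zero: "val \<zero> = 0"
  using val_add[of \<zero> \<zero>] by simp

lemma val_pos_smult:
  assumes x: "x \<in> herm V" and r: "r > 0"
  shows "val (complex_of_real r \<odot> x) = r * val x"
proof (rule val_eqI[OF herm_smult[OF x]])
  have xc: "x \<in> carrier V"
    using x by (rule herm_carrier)
  have scale: "complex_of_real t \<odot> u \<ominus> complex_of_real r \<odot> x =
      complex_of_real r \<odot> (complex_of_real (t / r) \<odot> u \<ominus> x)"
    "complex_of_real r \<odot> x \<ominus> complex_of_real t \<odot> u =
      complex_of_real r \<odot> (x \<ominus> complex_of_real (t / r) \<odot> u)" for t
    using xc r by (simp_all add: minus_eq_smult smult_add_right smult_smult)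
  show "cut_value V u P (complex_of_real r \<odot> x) (r * val x)"
    unfolding cut_value_def scale
    using cut_value_val[OF x] r
    by (auto simp: cut_value_def field_simps simp del: of_real_divide intro!: P_smult)
qed

lemma val_smult:
  assumes x: "x \<in> herm V"
  shows "val (complex_of_real r \<odot> x) = r * val x"
proof -
  consider "r > 0" | "r = 0" | "r < 0"
    by linarith
  then show ?thesis
  proof cases
    case 3
    have "complex_of_real r \<odot> x = \<ominus> (complex_of_real (- r) \<odot> x)"
      using herm_carrier[OF x] by (simp add: neg_eq_smult smult_smult)
    then show ?thesis
      using val_neg[OF herm_smult[OF x, of "- r"]] val_pos_smult[OF x, of "- r"] 3 by simp
  qed (use herm_carrier[OF x] val_zero val_pos_smult[OF x] in simp_all)
qed

lemma val_nonneg: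
  assumes x: "x \<in> P"
  shows "val x \<ge> 0"
proof (rule ccontr)
  have xh: "x \<in> herm V"
    using x P_herm by blast
  assume "\<not> val x \<ge> 0"
  then have "complex_of_real (val x / 2) \<odot> u \<ominus> x \<in> P"
    using cut_value_val[OF xh] unfolding cut_value_def by (simp del: of_real_divide)
  moreover have "x \<ominus> complex_of_real 0 \<odot> u \<in> P"
    using x P_carrier[OF x] by (simp add: a_minus_def)
  ultimately have "0 \<le> val x / 2"
    using cut_le[OF xh] by blast
  with \<open>\<not> val x \<ge> 0\<close> show False
    by simp
qed

lemma val_u: "val u = 1"
proof (rule val_eqI[OF u_herm])
  have "complex_of_real t \<odot> u \<ominus> u = complex_of_real (t - 1) \<odot> u"
    "u \<ominus> complex_of_real t \<odot> u = complex_of_real (1 - t) \<odot> u" for t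
    using smult_add_left[of u "complex_of_real t" "- 1"]
      smult_add_left[of u 1 "- complex_of_real t"]
    by (simp_all add: minus_eq_smult smult_smult)
  then show "cut_value V u P u 1"
    by (simp add: cut_value_def smult_u_in_P_iff del: of_real_diff)
qed

text \<open>
  The complex linear extension of \<open>val\<close> from the hermitian elements to all of \<open>V\<close>.
\<close>

definition cval :: "'a \<Rightarrow> complex" where
  "cval v = Complex (val (re_part V v)) (val (im_part V v))"

lemma val_minus: "x \<in> herm V \<Longrightarrow> y \<in> herm V \<Longrightarrow> val (x \<ominus> y) = val x - val y"
  by (simp add: a_minus_def val_add val_neg herm_neg)

lemma cval_module_hom: "cval \<in> LinearCombinations.module_hom class_ring V complex_space"
  unfolding LinearCombinations.module_hom_def
  by (auto simp: complex_space_def cval_def re_part_add im_part_add re_part_smult im_part_smult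
      val_add val_minus val_smult re_part_herm im_part_herm herm_smult complex_eq_iff)

lemma cval_herm: "x \<in> herm V \<Longrightarrow> cval x = complex_of_real (val x)"
  by (simp add: cval_def re_part_of_herm im_part_of_herm val_zero complex_eq_iff)

lemma state_cval:
  assumes "cone V \<subseteq> P"
  shows "state V u cval"
proof -
  have "cval x \<in> complex_of_real ` {0..}" if "x \<in> cone V" for x
    using that assms P_herm val_nonneg[of x] cval_herm[of x] by auto
  then show ?thesis
    using cval_module_hom cval_herm[OF u_herm] val_u by (auto simp: state_def)
qed

end

section \<open>States and the Archimedean cone\<close>

lemma (in ordered_star_vectorspace) wedge_cone: "wedge V (cone V)"
proof -
  obtain v where v: "v \<in> cone V"
    using cone_nonempty by blast
  then have "v \<in> carrier V"
    using cone_herm herm_carrier by blast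
  then have "\<zero> \<in> cone V"
    using cone_smult[OF v, of 0] by simp
  then show ?thesis
    using cone_herm cone_add cone_smult by (simp add: wedge_def)
qed

text \<open>
  Ordered \<open>*\<close>-vector spaces with order unit.
\<close>

locale unital_star_vectorspace = ordered_star_vectorspace +
  fixes u
  assumes unit: "order_unit V u"
begin

lemmas cone_zero = wedgeD(2)[OF wedge_cone] and cone_carrier = wedgeD(5)[OF wedge_cone]

lemma unit_herm: "u \<in> herm V" and unit_carrier [simp]: "u \<in> carrier V"
  using unit herm_carrier by (auto simp: order_unit_def)

lemma unit_bound: "x \<in> herm V \<Longrightarrow> \<exists>r>0. complex_of_real r \<odot> u \<ominus> x \<in> cone V"
  using unit by (auto simp: order_unit_def ord_le_def)

lemma unit_cone: "u \<in> cone V"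
proof -
  obtain r where r: "r > 0" "complex_of_real r \<odot> u \<ominus> \<zero> \<in> cone V"
    using unit_bound[OF herm_zero] by blast
  then have "complex_of_real (1 / r) \<odot> (complex_of_real r \<odot> u) \<in> cone V"
    by (intro cone_smult[where v = "complex_of_real r \<odot> u"])
      (simp_all add: a_minus_def del: of_real_divide)
  then show ?thesis
    using r by (simp add: smult_smult)
qed

lemma cone_antisym:
  assumes "v \<in> cone V" "\<ominus> v \<in> cone V"
  shows "v = \<zero>"
proof -
  have "v = \<ominus> (\<ominus> v)"
    using cone_carrier[OF assms(1)] by simp
  then have "v \<in> cone V \<inter> a_inv V ` cone V"
    using assms by blast
  then show ?thesis
    using cone_proper by simp
qed

lemma wedge_arch_cone: "wedge V (arch_cone V u)"
  unfolding arch_cone_eq_arch_closure by (rule wedge_arch_closure[OF wedge_cone unit_cone])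

text \<open>
  States detect the Archimedean cone. If \<open>y = r u + v\<close> is not positive for some \<open>r > 0\<close>, then \<open>-u\<close>
  stays outside the wedge generated by the cone and \<open>-y\<close>. A total wedge above it yields a
  state with \<open>f y \<le> 0\<close>, that is, \<open>f v \<le> -r\<close>.
\<close>

lemma ex_negative_state:
  assumes v: "v \<in> herm V" and notin: "v \<notin> arch_cone V u"
  shows "\<exists>f a. state V u f \<and> f v = complex_of_real a \<and> a < 0"
proof -
  obtain r where r: "r > 0" "complex_of_real r \<odot> u \<oplus> v \<notin> cone V"
    using assms by (auto simp: arch_cone_def)
  define y where "y = complex_of_real r \<odot> u \<oplus> v"
  have y: "y \<in> herm V"
    using v unit_herm by (simp add: y_def herm_add herm_smult)
  then have yc: "y \<in> carrier V"
    by (rule herm_carrier)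
  let ?Q = "adjoin V (cone V) (\<ominus> y)"
  have neg_u: "\<ominus> u \<notin> cone V"
  proof
    assume "\<ominus> u \<in> cone V"
    \<comment> \<open>if \<open>-u\<close> is positive then \<open>u = 0\<close>, and every hermitian element is positive\<close>
    then have "u = \<zero>"
      by (rule cone_antisym[OF unit_cone])
    moreover obtain s where "complex_of_real s \<odot> u \<ominus> (\<ominus> y) \<in> cone V"
      using unit_bound[OF herm_neg[OF y]] by blast
    ultimately have "y \<in> cone V"
      using yc by (simp add: a_minus_def)
    with r show False
      by (simp add: y_def)
  qed
  have Q: "wedge V ?Q" "cone V \<subseteq> ?Q" "\<ominus> y \<in> ?Q"
    using wedge_adjoin[OF wedge_cone herm_neg[OF y]] by auto
  have "\<ominus> u \<notin> ?Q"
  proof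
    assume "\<ominus> u \<in> ?Q"
    then have "\<ominus> (\<ominus> y) \<in> cone V"
      by (rule neg_in_wedge_if_adjoin[OF wedge_cone herm_neg[OF y] unit_cone neg_u])
    with r yc show False
      by (simp add: y_def)
  qed
  then obtain P where M: "wedge V P" "?Q \<subseteq> P" "\<ominus> u \<notin> P"
    "\<And>x. x \<in> herm V \<Longrightarrow> x \<in> P \<or> \<ominus> x \<in> P"
    using maximal_wedge[OF Q(1), of u] Q(2) unit_cone by blast
  interpret total_wedge V u P
    using M Q(2) unit_cone unit_bound by unfold_locales blast+
  have "0 \<le> val (\<ominus> y)"
    using val_nonneg M(2) Q(3) by blast
  also have "val (\<ominus> y) = - (r + val v)"
    using val_neg[OF y] v u_herm val_u by (simp add: y_def val_add val_smult herm_smult)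
  finally have "val v < 0"
    using r by simp
  then show ?thesis
    using state_cval cval_herm[OF v] M(2) Q(2) by blast
qed

lemma state_herm_real:
  assumes f: "state V u f" and x: "x \<in> herm V"
  shows "Im (f x) = 0"
proof -
  obtain r where r: "complex_of_real r \<odot> u \<ominus> x \<in> cone V"
    using unit_bound[OF x] by blast
  note hom = f[unfolded state_def LinearCombinations.module_hom_def complex_space_def, simplified]
  have xc: "x \<in> carrier V"
    using x by (rule herm_carrier)
  have "f (complex_of_real r \<odot> u \<ominus> x) = complex_of_real r - f x"
    using hom xc by (simp add: minus_eq_smult)
  moreover have "f (complex_of_real r \<odot> u \<ominus> x) \<in> complex_of_real ` {0..}"
    using hom r by blast
  ultimately show ?thesis
    by (auto simp: complex_eq_iff)
qed

lemma state_arch_cone_nonneg: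
  assumes f: "state V u f" and x: "x \<in> arch_cone V u"
  shows "Re (f x) \<ge> 0"
proof (rule field_le_epsilon)
  fix r :: real assume "r > 0"
  note hom = f[unfolded state_def LinearCombinations.module_hom_def complex_space_def, simplified]
  have xc: "x \<in> carrier V"
    using x herm_carrier by (simp add: arch_cone_def)
  have "f (complex_of_real r \<odot> u \<oplus> x) = complex_of_real r + f x"
    using hom xc by simp
  moreover have "f (complex_of_real r \<odot> u \<oplus> x) \<in> complex_of_real ` {0..}"
    using hom x \<open>r > 0\<close> by (auto simp: arch_cone_def)
  ultimately show "0 \<le> Re (f x) + r"
    by (auto simp: complex_eq_iff)
qed

lemma state_kernel_eq: "state_kernel V u = complexification V (lineality V (arch_cone V u))"
proof (intro equalityI subsetI)
  fix v assume v: "v \<in> complexification V (lineality V (arch_cone V u))"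
  then have vc: "v \<in> carrier V"
    by (simp add: complexification_def)
  have "f v = 0" if f: "state V u f" for f
  proof -
    note hom = f[unfolded state_def LinearCombinations.module_hom_def complex_space_def, simplified]
    have zero: "f x = 0" if x: "x \<in> lineality V (arch_cone V u)" for x
    proof -
      have xh: "x \<in> herm V"
        using x by (simp add: lineality_def arch_cone_def)
      have "f (\<ominus> x) = - f x"
        using hom herm_carrier[OF xh] by (simp add: neg_eq_smult)
      then show ?thesis
        using x state_herm_real[OF f xh] state_arch_cone_nonneg[OF f, of x]
          state_arch_cone_nonneg[OF f, of "\<ominus> x"]
        by (simp add: lineality_def complex_eq_iff)
    qed
    have "f v = f (re_part V v \<oplus> \<i> \<odot> im_part V v)"
      using re_im_decomp[OF vc] by simp
    also have "\<dots> = f (re_part V v) + \<i> * f (im_part V v)"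
      using hom vc by simp
    finally show ?thesis
      using v zero by (simp add: complexification_def)
  qed
  then show "v \<in> state_kernel V u"
    using vc by (simp add: state_kernel_def)
next
  fix v assume "v \<in> state_kernel V u"
  then have vc: "v \<in> carrier V" and zero: "\<And>f. state V u f \<Longrightarrow> f v = 0"
    by (simp_all add: state_kernel_def)
  have in_arch: "x \<in> arch_cone V u" if x: "x \<in> herm V" and "\<And>f. state V u f \<Longrightarrow> f x = 0" for x
    using ex_negative_state[OF x] that by fastforce
  have "f (re_part V v) = 0 \<and> f (im_part V v) = 0 \<and>
      f (\<ominus> re_part V v) = 0 \<and> f (\<ominus> im_part V v) = 0" if f: "state V u f" for f
  proof -
    note hom = f[unfolded state_def LinearCombinations.module_hom_def complex_space_def, simplified]
    have "0 = f (re_part V v \<oplus> \<i> \<odot> im_part V v)"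
      using re_im_decomp[OF vc] zero[OF f] by simp
    also have "\<dots> = f (re_part V v) + \<i> * f (im_part V v)"
      using hom vc by simp
    finally have "f (re_part V v) = 0 \<and> f (im_part V v) = 0"
      using state_herm_real[OF f] re_part_herm[OF vc] im_part_herm[OF vc]
      by (simp add: complex_eq_iff)
    then show ?thesis
      using hom vc by (simp add: neg_eq_smult)
  qed
  then show "v \<in> complexification V (lineality V (arch_cone V u))"
    using vc re_part_herm[OF vc] im_part_herm[OF vc] herm_neg
    by (auto simp: complexification_def lineality_def intro!: in_arch)
qed

end

section \<open>The quotient by the lineality space of a wedge\<close>

text \<open>
  The quotient by the complexified lineality space of a wedge \<open>Q\<close>, with the image of \<open>Q\<close> as its cone.
  The cone of \<open>V\<close> is not required to satisfy any axioms here.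
\<close>

locale wedge_quotient = star_vectorspace +
  fixes Q
  assumes Q: "wedge V Q"
begin

abbreviation "N \<equiv> complexification V (lineality V Q)"

abbreviation "W \<equiv> quot_space V N Q"

lemmas Q_herm = wedgeD(1)[OF Q] and Q_zero = wedgeD(2)[OF Q] and Q_add = wedgeD(3)[OF Q]
  and Q_smult = wedgeD(4)[OF Q] and Q_carrier = wedgeD(5)[OF Q]

sublocale N: star_quotient V N
  by unfold_locales (rule selfadjoint_complexification[OF real_subspace_lineality[OF Q]])

lemma coset_eq_re_part:
  assumes v: "v \<in> carrier V" and im: "im_part V v \<in> lineality V Q"
  shows "N +> v = N +> re_part V v"
proof (rule N.coset_eqI)
  show "v \<ominus> re_part V v \<in> N"
    using v im Q_zero re_part_herm[OF v] re_part_of_herm im_part_of_herm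
    by (simp add: complexification_def re_part_minus im_part_minus lineality_def)
      (simp add: a_minus_def M.r_neg)
qed (use v in auto)

text \<open>
  A representative of a positive coset need not be in \<open>Q\<close>, nor be hermitian. Positivity is visible
  on its real part, up to an imaginary part in the lineality space.
\<close>

lemma coset_in_cone_iff:
  assumes v: "v \<in> carrier V"
  shows "N +> v \<in> cone W \<longleftrightarrow> re_part V v \<in> Q \<and> im_part V v \<in> lineality V Q"
proof
  assume "N +> v \<in> cone W"
  then obtain w where w: "w \<in> Q" "N +> v = N +> w"
    by (auto simp: N.quot_cone)
  have wh: "w \<in> herm V"
    using w Q_herm by blast
  then have wc: "w \<in> carrier V"
    by (rule herm_carrier)
  have "v \<ominus> w \<in> N"
    using N.coset_eq_iff[OF v wc] w by simp
  then have "re_part V v \<ominus> w \<in> Q" "im_part V v \<in> lineality V Q"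
    using v wc wh by (simp_all add: complexification_def re_part_minus im_part_minus
        re_part_of_herm im_part_of_herm lineality_def) (simp_all add: a_minus_def)
  moreover from this have "re_part V v \<in> Q"
    using Q_add[OF w(1), of "re_part V v \<ominus> w"] v wc by (simp add: add_minus_cancel)
  ultimately show "re_part V v \<in> Q \<and> im_part V v \<in> lineality V Q"
    by simp
next
  assume "re_part V v \<in> Q \<and> im_part V v \<in> lineality V Q"
  then show "N +> v \<in> cone W"
    using coset_eq_re_part[OF v] by (simp add: N.quot_cone)
qed

lemma coset_herm_in_cone_iff: "v \<in> herm V \<Longrightarrow> N +> v \<in> cone W \<longleftrightarrow> v \<in> Q"
  using coset_in_cone_iff[of v] Q_zero
  by (simp add: herm_carrier re_part_of_herm im_part_of_herm lineality_def)

lemma quot_ordered: "ordered_star_vectorspace W"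
proof (intro ordered_star_vectorspace.intro N.quot_star_vectorspace
    ordered_star_vectorspace_axioms.intro)
  show "cone W \<noteq> {}"
    using Q_zero by (auto simp: N.quot_cone)
  show "cone W \<subseteq> herm W"
    using Q_herm by (auto simp: N.quot_cone N.quot_herm)
next
  fix X Y assume "X \<in> cone W" "Y \<in> cone W"
  then obtain v w where "v \<in> Q" "w \<in> Q" "X = N +> v" "Y = N +> w"
    by (auto simp: N.quot_cone)
  then show "X \<oplus>\<^bsub>W\<^esub> Y \<in> cone W"
    using Q_add Q_carrier by (simp add: N.quot_cone N.quot_add)
next
  fix X and r :: real assume "X \<in> cone W" "r \<ge> 0"
  then obtain v where "v \<in> Q" "X = N +> v"
    by (auto simp: N.quot_cone)
  then show "complex_of_real r \<odot>\<^bsub>W\<^esub> X \<in> cone W"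
    using Q_smult \<open>r \<ge> 0\<close> Q_carrier by (simp add: N.quot_cone N.quot_smult)
next
  show "cone W \<inter> a_inv W ` cone W = {\<zero>\<^bsub>W\<^esub>}"
  proof
    show "cone W \<inter> a_inv W ` cone W \<subseteq> {\<zero>\<^bsub>W\<^esub>}"
    proof
      fix X assume X: "X \<in> cone W \<inter> a_inv W ` cone W"
      then obtain w where w: "w \<in> Q" "X = \<ominus>\<^bsub>W\<^esub> (N +> w)"
        by (auto simp: N.quot_cone)
      have wh: "w \<in> herm V" and wc: "w \<in> carrier V"
        using w Q_herm Q_carrier by auto
      have Xw: "X = N +> \<ominus> w"
        using w wc by (simp add: N.quot_neg)
      then have "\<ominus> w \<in> Q"
        using X coset_herm_in_cone_iff[OF herm_neg[OF wh]] by simp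
      then have "\<ominus> w \<in> lineality V Q"
        using w wc by (simp add: lineality_def)
      then have "\<ominus> w \<in> N"
        using herm_complexification_iff[OF real_subspace_lineality[OF Q] herm_neg[OF wh]] by simp
      then show "X \<in> {\<zero>\<^bsub>W\<^esub>}"
        using Xw wc N.coset_eq_J_iff[of "\<ominus> w"] by (simp add: N.quot_zero N.coset_zero)
    qed
    have "\<zero>\<^bsub>W\<^esub> \<in> cone W" "\<zero>\<^bsub>W\<^esub> = \<ominus>\<^bsub>W\<^esub> \<zero>\<^bsub>W\<^esub>"
      using Q_zero by (simp_all add: N.quot_cone N.quot_zero N.quot_neg)
    then show "{\<zero>\<^bsub>W\<^esub>} \<subseteq> cone W \<inter> a_inv W ` cone W"
      by blast
  qed
qed

lemma coset_ord_le_iff: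
  assumes "v \<in> herm V" "w \<in> herm V"
  shows "ord_le W (N +> v) (N +> w) \<longleftrightarrow> w \<ominus> v \<in> Q"
  using assms herm_carrier
  by (simp add: ord_le_def N.quot_herm N.quot_minus herm_minus coset_herm_in_cone_iff)

lemma quot_order_unit:
  assumes e: "order_unit V e" and "cone V \<subseteq> Q"
  shows "order_unit W (N +> e)"
  unfolding order_unit_def
proof (intro conjI ballI)
  have eh: "e \<in> herm V"
    using e by (simp add: order_unit_def)
  then show "N +> e \<in> herm W"
    by (simp add: N.quot_herm)
  fix X assume "X \<in> herm W"
  then obtain x where x: "x \<in> herm V" "X = N +> x"
    by (auto simp: N.quot_herm)
  then obtain r where "r > 0" "complex_of_real r \<odot> e \<ominus> x \<in> cone V"
    using e by (auto simp: order_unit_def ord_le_def)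
  then show "\<exists>r>0. ord_le W X (complex_of_real r \<odot>\<^bsub>W\<^esub> (N +> e))"
    using x eh assms(2) herm_carrier[OF eh]
    by (intro exI[of _ r]) (auto simp: N.quot_smult coset_ord_le_iff herm_smult)
qed

lemma quot_archimedean_order_unit:
  assumes e: "order_unit V e" and "cone V \<subseteq> Q"
    and arch: "\<And>x. x \<in> herm V \<Longrightarrow>
      (\<And>r. r > 0 \<Longrightarrow> complex_of_real r \<odot> e \<oplus> x \<in> Q) \<Longrightarrow> x \<in> Q"
  shows "archimedean_order_unit W (N +> e)"
  unfolding archimedean_order_unit_def
proof (intro conjI ballI impI)
  show "order_unit W (N +> e)"
    using e assms(2) by (rule quot_order_unit)
  have eh: "e \<in> herm V"
    using e by (simp add: order_unit_def)
  have ec: "e \<in> carrier V"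
    using eh by (rule herm_carrier)
  have nonneg: "ord_le W \<zero>\<^bsub>W\<^esub> (N +> x) \<longleftrightarrow> x \<in> Q" if "x \<in> herm V" for x
    using coset_ord_le_iff[OF herm_zero that] herm_carrier[OF that]
    by (simp add: N.quot_zero a_minus_def)
  fix X assume "X \<in> herm W"
    and *: "\<forall>r>0. ord_le W \<zero>\<^bsub>W\<^esub> (complex_of_real r \<odot>\<^bsub>W\<^esub> (N +> e) \<oplus>\<^bsub>W\<^esub> X)"
  then obtain x where x: "x \<in> herm V" "X = N +> x"
    by (auto simp: N.quot_herm)
  have xc: "x \<in> carrier V"
    using x herm_carrier by blast
  have "complex_of_real r \<odot> e \<oplus> x \<in> Q" if "r > 0" for r
    using that * x eh ec xc
    by (simp add: N.quot_smult N.quot_add nonneg herm_add herm_smult)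
  then show "ord_le W \<zero>\<^bsub>W\<^esub> X"
    using arch x nonneg by simp
qed

end

section \<open>Archimedean quotients by order ideals\<close>

text \<open>
  Two surjective linear maps that identify the same elements have isomorphic images.
\<close>

lemma induced_module_iso:
  assumes p: "p \<in> LinearCombinations.module_hom R A B" "p ` carrier A = carrier B"
    and q: "q \<in> LinearCombinations.module_hom R A C" "q ` carrier A = carrier C"
    and A: "Module.module R A"
    and ker: "\<And>x y. x \<in> carrier A \<Longrightarrow> y \<in> carrier A \<Longrightarrow> p x = p y \<longleftrightarrow> q x = q y"
  shows "\<exists>\<phi>\<in>LinearCombinations.module_hom R B C. bij_betw \<phi> (carrier B) (carrier C) \<and>
    (\<forall>x\<in>carrier A. \<phi> (p x) = q x)"
proof -
  interpret A: Module.module R A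
    by (rule A)
  define \<phi> where "\<phi> b = q (SOME x. x \<in> carrier A \<and> p x = b)" for b
  have \<phi>: "\<phi> (p x) = q x" if x: "x \<in> carrier A" for x
  proof -
    have "\<exists>y. y \<in> carrier A \<and> p y = p x"
      using x by blast
    from someI_ex[OF this] show ?thesis
      unfolding \<phi>_def using ker x by blast
  qed
  note ph = p(1)[unfolded LinearCombinations.module_hom_def, simplified]
    and qh = q(1)[unfolded LinearCombinations.module_hom_def, simplified]
  have "\<phi> \<in> LinearCombinations.module_hom R B C"
    unfolding LinearCombinations.module_hom_def
  proof (intro CollectI conjI allI impI)
    show "\<phi> \<in> carrier B \<rightarrow> carrier C"
      using \<phi> q(2) by (auto simp flip: p(2))
  next
    fix b c assume "b \<in> carrier B \<and> c \<in> carrier B"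
    then obtain x y where xy: "x \<in> carrier A" "y \<in> carrier A" "b = p x" "c = p y"
      unfolding p(2)[symmetric] by blast
    then have "b \<oplus>\<^bsub>B\<^esub> c = p (x \<oplus>\<^bsub>A\<^esub> y)"
      using ph by simp
    then show "\<phi> (b \<oplus>\<^bsub>B\<^esub> c) = \<phi> b \<oplus>\<^bsub>C\<^esub> \<phi> c"
      using xy qh \<phi> by simp
  next
    fix r b assume "r \<in> carrier R \<and> b \<in> carrier B"
    then obtain x where x: "r \<in> carrier R" "x \<in> carrier A" "b = p x"
      unfolding p(2)[symmetric] by blast
    then have "r \<odot>\<^bsub>B\<^esub> b = p (r \<odot>\<^bsub>A\<^esub> x)"
      using ph by simp
    then show "\<phi> (r \<odot>\<^bsub>B\<^esub> b) = r \<odot>\<^bsub>C\<^esub> \<phi> b"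
      using x qh \<phi> by simp
  qed
  moreover have "bij_betw \<phi> (carrier B) (carrier C)"
    unfolding bij_betw_def
  proof
    show "inj_on \<phi> (carrier B)"
      unfolding p(2)[symmetric] using \<phi> ker by (auto simp: inj_on_def)
    show "\<phi> ` carrier B = carrier C"
      unfolding p(2)[symmetric] q(2)[symmetric] image_image using \<phi> by (intro image_cong) auto
  qed
  ultimately show ?thesis
    using \<phi> by blast
qed

locale order_ideal_quotient = unital_star_vectorspace V e for V :: "'a ostar" (structure) and e +
  fixes J
  assumes ideal: "order_ideal V J"
begin

sublocale J: star_quotient V J
  using ideal by unfold_locales (simp add: order_ideal_def)

text \<open>
  The hermitian representatives of the positive elements of \<open>V/J\<close>.
\<close>

definition QJ :: "'a set" where
  "QJ = {v \<in> herm V. \<exists>j\<in>J \<inter> herm V. j \<oplus> v \<in> cone V}"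

text \<open>
  The hermitian representatives of the positive elements of \<open>V/N\<^sub>J\<close>. With the sublocale \<open>P\<close>
  below, \<open>P.N\<close> is \<open>N\<^sub>J\<close> and \<open>P.W\<close> is \<open>V/N\<^sub>J\<close>.
\<close>

definition PJ :: "'a set" where
  "PJ = arch_closure V e QJ"

lemma wedge_QJ: "wedge V QJ"
  unfolding wedge_def
proof (intro conjI ballI allI impI)
  show "QJ \<subseteq> herm V"
    by (auto simp: QJ_def)
  show "\<zero> \<in> QJ"
    using cone_zero by (auto simp: QJ_def intro!: bexI[of _ \<zero>])
next
  fix v w assume "v \<in> QJ" "w \<in> QJ"
  then obtain j k where *: "v \<in> herm V" "w \<in> herm V" "j \<in> J \<inter> herm V" "k \<in> J \<inter> herm V"
    "j \<oplus> v \<in> cone V" "k \<oplus> w \<in> cone V"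
    by (auto simp: QJ_def)
  then have "(j \<oplus> v) \<oplus> (k \<oplus> w) \<in> cone V"
    using cone_add by blast
  also have "(j \<oplus> v) \<oplus> (k \<oplus> w) = (j \<oplus> k) \<oplus> (v \<oplus> w)"
    using * herm_carrier by (simp add: M.a_ac)
  finally show "v \<oplus> w \<in> QJ"
    using * J.J_add herm_add by (auto simp: QJ_def intro!: bexI[of _ "j \<oplus> k"])
next
  fix r :: real and v assume "v \<in> QJ" and r: "r \<ge> 0"
  then obtain j where *: "v \<in> herm V" "j \<in> J \<inter> herm V" "j \<oplus> v \<in> cone V"
    by (auto simp: QJ_def)
  then have "complex_of_real r \<odot> (j \<oplus> v) \<in> cone V"
    using cone_smult r by blast
  also have "complex_of_real r \<odot> (j \<oplus> v) = complex_of_real r \<odot> j \<oplus> complex_of_real r \<odot> v"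
    using * herm_carrier by (simp add: smult_add_right)
  finally show "complex_of_real r \<odot> v \<in> QJ"
    using * J.J_smult herm_smult by (auto simp: QJ_def intro!: bexI[of _ "complex_of_real r \<odot> j"])
qed

lemma cone_subset_QJ: "cone V \<subseteq> QJ"
  using cone_herm cone_carrier by (auto simp: QJ_def intro!: bexI[of _ \<zero>])

text \<open>
  This is where \<open>J\<close> being an order ideal enters: if \<open>j + v\<close> and \<open>k - v\<close> are positive, then
  \<open>0 \<le> j + v \<le> j + k \<in> J\<close>, so that \<open>v \<in> J\<close>.
\<close>

lemma lineality_QJ: "lineality V QJ = J \<inter> herm V"
proof (intro equalityI subsetI)
  fix v assume "v \<in> lineality V QJ"
  then obtain j k where *: "v \<in> herm V" "j \<in> J \<inter> herm V" "k \<in> J \<inter> herm V"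
    "j \<oplus> v \<in> cone V" "k \<oplus> \<ominus> v \<in> cone V"
    by (auto simp: lineality_def QJ_def)
  have c: "v \<in> carrier V" "j \<in> carrier V" "k \<in> carrier V"
    using * herm_carrier by auto
  have sum: "(j \<oplus> v) \<oplus> (k \<oplus> \<ominus> v) = j \<oplus> k"
    using c by (simp add: M.a_ac M.r_neg M.r_neg1 M.r_neg2)
  have "(j \<oplus> k) \<ominus> (j \<oplus> v) = (k \<oplus> j) \<oplus> (\<ominus> j \<oplus> \<ominus> v)"
    using c by (simp add: a_minus_def M.minus_add M.a_comm)
  also have "\<dots> = k \<oplus> \<ominus> v"
    using c by (simp add: M.a_assoc M.r_neg1 M.r_neg2)
  finally have "(j \<oplus> k) \<ominus> (j \<oplus> v) = k \<oplus> \<ominus> v" .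
  then have "ord_le V (j \<oplus> v) (j \<oplus> k)"
    using * herm_add by (simp add: ord_le_def)
  moreover have "ord_le V \<zero> (j \<oplus> v)"
    using * herm_add c by (simp add: ord_le_def a_minus_def)
  moreover have "j \<oplus> k \<in> J \<inter> cone V"
    using * J.J_add cone_add sum by (metis IntD1 IntI)
  ultimately have "j \<oplus> v \<in> J"
    using ideal unfolding order_ideal_def by blast
  then have "\<ominus> j \<oplus> (j \<oplus> v) \<in> J"
    using J.J_add J.J_neg * by blast
  then show "v \<in> J \<inter> herm V"
    using * c by (simp add: M.r_neg1)
next
  fix v assume v: "v \<in> J \<inter> herm V"
  then have "v \<in> carrier V" "\<ominus> v \<in> J \<inter> herm V"
    using herm_carrier J.J_neg herm_neg by auto
  then show "v \<in> lineality V QJ"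
    using v cone_zero
    by (auto simp: lineality_def QJ_def M.l_neg M.r_neg intro: bexI[of _ v] bexI[of _ "\<ominus> v"])
qed

lemma J_eq: "J = complexification V (lineality V QJ)"
  unfolding lineality_QJ by (rule selfadjoint_eq_complexification[OF J.J])

sublocale Q: wedge_quotient V QJ
  by unfold_locales (rule wedge_QJ)

lemma unit_QJ: "e \<in> QJ"
  using unit_cone cone_subset_QJ by blast

lemma wedge_PJ: "wedge V PJ"
  unfolding PJ_def by (rule wedge_arch_closure[OF wedge_QJ unit_QJ])

lemma QJ_subset_PJ: "QJ \<subseteq> PJ"
  unfolding PJ_def by (rule subset_arch_closure[OF wedge_QJ unit_QJ])

sublocale P: wedge_quotient V PJ
  by unfold_locales (rule wedge_PJ)

lemma quot_cone_eq: "quot_space V J (cone V) = quot_space V J QJ"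
proof -
  have "(\<lambda>v. J +> v) ` QJ \<subseteq> (\<lambda>v. J +> v) ` cone V"
  proof
    fix X assume "X \<in> (\<lambda>v. J +> v) ` QJ"
    then obtain v j where *: "v \<in> herm V" "j \<in> J" "j \<oplus> v \<in> cone V" "X = J +> v"
      by (auto simp: QJ_def)
    have c: "v \<in> carrier V" "j \<in> carrier V"
      using * herm_carrier J.J_in_carrier by auto
    have "J +> (j \<oplus> v) = J +> v"
      using c * by (intro J.coset_eqI) (simp_all add: a_minus_def M.a_assoc M.r_neg)
    then show "X \<in> (\<lambda>v. J +> v) ` cone V"
      using * by blast
  qed
  then have "(\<lambda>v. J +> v) ` cone V = (\<lambda>v. J +> v) ` QJ"
    using cone_subset_QJ by blast
  then show ?thesis
    by (simp add: quot_space_def)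
qed

lemma N_real_eq: "N_real V e J = lineality V PJ"
proof -
  have "(\<exists>j\<in>J \<inter> herm V. j \<oplus> complex_of_real r \<odot> e \<oplus> v \<in> cone V) \<longleftrightarrow>
      complex_of_real r \<odot> e \<oplus> v \<in> QJ" if "v \<in> herm V" for r v
    using that herm_carrier unit_herm
    by (auto simp: QJ_def herm_add herm_smult M.a_assoc)
  then show ?thesis
    using herm_neg by (auto simp: N_real_def lineality_def PJ_def arch_closure_def a_minus_def)
qed

lemma N_ideal_eq: "N_ideal V e J = P.N"
  unfolding N_ideal_def N_real_eq
  by (rule complexification_eq_sum[OF real_subspace_lineality[OF wedge_PJ], symmetric])

text \<open>
  The representatives in the definition of \<open>(V/N\<^sub>J)\<^sup>+\<close> need not be hermitian. Their imaginary
  parts lie in \<open>J\<close>, so passing to real parts does not change the cosets.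
\<close>

lemma N_quotient_eq: "N_quotient V e J = P.W"
proof -
  let ?C = "{v \<in> carrier V. \<forall>r>0. \<exists>j\<in>J. j \<oplus> complex_of_real r \<odot> e \<oplus> v \<in> cone V}"
  have sub: "PJ \<subseteq> ?C"
  proof
    fix v assume "v \<in> PJ"
    then have "v \<in> carrier V" and "\<forall>r>0. \<exists>j\<in>J. j \<oplus> (complex_of_real r \<odot> e \<oplus> v) \<in> cone V"
      using herm_carrier by (auto simp: PJ_def arch_closure_def QJ_def)
    then show "v \<in> ?C"
      using J.J_in_carrier by (simp add: M.a_assoc cong: bex_cong)
  qed
  moreover have "re_part V v \<in> PJ \<and> im_part V v \<in> lineality V PJ" if "v \<in> ?C" for v
  proof -
    have v: "v \<in> carrier V"
      using that by simp
    have *: "complex_of_real r \<odot> e \<oplus> re_part V v \<in> QJ \<and> im_part V v \<in> J \<inter> herm V"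
      if r: "r > 0" for r
    proof -
      obtain j where j: "j \<in> J" "j \<oplus> complex_of_real r \<odot> e \<oplus> v \<in> cone V" (is "?c \<in> _")
        using \<open>v \<in> ?C\<close> r by blast
      have jc: "j \<in> carrier V" and re_j: "re_part V j \<in> J \<inter> herm V" "im_part V j \<in> J \<inter> herm V"
        using j J.J_in_carrier selfadjoint_re_im[OF J.J] re_part_herm im_part_herm by auto
      have c: "?c \<in> herm V"
        using j cone_herm by blast
      have "re_part V ?c = re_part V j \<oplus> (complex_of_real r \<odot> e \<oplus> re_part V v)"
        using jc v unit_herm
        by (simp add: re_part_add re_part_real_smult re_part_of_herm M.a_assoc)
      then have "complex_of_real r \<odot> e \<oplus> re_part V v \<in> QJ"
        using j re_j re_part_of_herm[OF c] re_part_herm[OF v] unit_herm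
        by (auto simp: QJ_def herm_add herm_smult)
      moreover have "im_part V ?c = im_part V j \<oplus> im_part V v"
        using jc v unit_herm by (simp add: im_part_add im_part_real_smult im_part_of_herm)
      then have "im_part V j \<oplus> im_part V v = \<zero>"
        using im_part_of_herm[OF c] by simp
      then have "im_part V v = \<ominus> im_part V j"
        using jc v by (metis M.a_comm M.minus_equality im_part_carrier)
      then have "im_part V v \<in> J \<inter> herm V"
        using re_j J.J_neg herm_neg by auto
      ultimately show ?thesis
        by blast
    qed
    have "im_part V v \<in> lineality V QJ"
      using *[of 1] by (simp add: lineality_QJ)
    then show ?thesis
      using * re_part_herm[OF v] QJ_subset_PJ by (auto simp: PJ_def arch_closure_def lineality_def)
  qed
  then have "(\<lambda>v. P.N +> v) ` ?C \<subseteq> (\<lambda>v. P.N +> v) ` PJ"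
    using P.coset_eq_re_part by fastforce
  ultimately have "(\<lambda>v. P.N +> v) ` ?C = (\<lambda>v. P.N +> v) ` PJ"
    by blast
  then show ?thesis
    unfolding N_quotient_def N_ideal_eq by (simp add: quot_space_def)
qed

lemma order_ideal_N: "order_ideal V P.N"
  unfolding order_ideal_def
proof (intro conjI allI impI)
  show "selfadjoint_subspace V P.N"
    by (rule P.N.J)
  fix p q assume *: "p \<in> P.N \<inter> cone V \<and> ord_le V \<zero> q \<and> ord_le V q p"
  have h: "p \<in> herm V" "q \<in> herm V"
    using * by (auto simp: ord_le_def)
  have c: "p \<in> carrier V" "q \<in> carrier V"
    using h herm_carrier by auto
  note iff = herm_complexification_iff[OF real_subspace_lineality[OF wedge_PJ]]
  have "q \<in> PJ" "p \<ominus> q \<in> PJ"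
    using * c cone_subset_QJ QJ_subset_PJ by (auto simp: ord_le_def a_minus_def)
  moreover have "\<ominus> p \<in> PJ"
    using * iff[OF h(1)] by (simp add: lineality_def)
  ultimately have "\<ominus> p \<oplus> (p \<ominus> q) \<in> PJ"
    using P.Q_add by blast
  then have "\<ominus> q \<in> PJ"
    using c by (simp add: a_minus_def M.r_neg1)
  with \<open>q \<in> PJ\<close> show "q \<in> P.N"
    using iff[OF h(2)] by (simp add: lineality_def)
qed

lemma archimedean_N_quotient: "archimedean_order_unit P.W (P.N +> e)"
proof (rule P.quot_archimedean_order_unit[OF unit])
  show "cone V \<subseteq> PJ"
    using cone_subset_QJ QJ_subset_PJ by blast
  show "x \<in> PJ" if "x \<in> herm V" "\<And>r. r > 0 \<Longrightarrow> complex_of_real r \<odot> e \<oplus> x \<in> PJ" for x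
    using that arch_closure_closed[OF unit_herm] unfolding PJ_def by blast
qed

text \<open>
  The ordered space \<open>V/J\<close>, by \<open>quot_cone_eq\<close>. Its Archimedeanization is \<open>A.W\<close> for the sublocale
  \<open>A\<close> below.
\<close>

abbreviation "U \<equiv> quot_space V J QJ"

sublocale U: unital_star_vectorspace U "J +> e"
  using Q.quot_ordered Q.quot_order_unit[OF unit cone_subset_QJ] J_eq
  by (simp add: unital_star_vectorspace_def unital_star_vectorspace_axioms_def)

lemma coset_in_cone_U_iff: "v \<in> herm V \<Longrightarrow> J +> v \<in> cone U \<longleftrightarrow> v \<in> QJ"
  using Q.coset_herm_in_cone_iff J_eq by simp

lemma coset_in_arch_cone_iff:
  assumes v: "v \<in> herm V"
  shows "J +> v \<in> arch_cone U (J +> e) \<longleftrightarrow> v \<in> PJ"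
  using v herm_carrier[OF v] unit_herm
  by (simp add: arch_cone_def PJ_def arch_closure_def J.quot_herm J.quot_smult J.quot_add
      coset_in_cone_U_iff herm_add herm_smult)

lemma coset_in_lineality_iff:
  assumes v: "v \<in> herm V"
  shows "J +> v \<in> lineality U (arch_cone U (J +> e)) \<longleftrightarrow> v \<in> lineality V PJ"
  using v herm_carrier[OF v] herm_neg[OF v]
  by (simp add: lineality_def J.quot_neg coset_in_arch_cone_iff)

sublocale A: wedge_quotient U "arch_cone U (J +> e)"
  by unfold_locales (rule U.wedge_arch_cone)

text \<open>
  Here \<open>A.N\<close> is the intersection of the kernels of all states of \<open>V/J\<close>, by \<open>state_kernel_eq\<close>.
\<close>

lemma coset_in_state_kernel_iff:
  assumes v: "v \<in> carrier V"
  shows "J +> v \<in> A.N \<longleftrightarrow> v \<in> P.N"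
  using v J.coset_in_quot[OF v] re_part_herm[OF v] im_part_herm[OF v]
  by (simp add: complexification_def J.quot_re_part J.quot_im_part coset_in_lineality_iff)

lemma arch_quotient_eq: "arch_quotient V e J = A.W"
  by (simp add: arch_quotient_def archimedeanization_def quot_cone_eq U.state_kernel_eq)

lemma arch_quotient_unit_eq: "arch_quotient_unit V e J = A.N +>\<^bsub>U\<^esub> (J +> e)"
  by (simp add: arch_quotient_unit_def archimedeanization_unit_def quot_cone_eq U.state_kernel_eq)

lemma iso: "unitally_order_isomorphic A.W (A.N +>\<^bsub>U\<^esub> (J +> e)) P.W (P.N +> e)"
proof -
  let ?p = "\<lambda>v. A.N +>\<^bsub>U\<^esub> (J +> v)" and ?q = "\<lambda>v. P.N +> v"
  have surj: "?p ` carrier V = carrier A.W" "?q ` carrier V = carrier P.W"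
    by (simp_all add: A.N.quot_carrier P.N.quot_carrier J.quot_carrier image_image)
  have "?p \<in> LinearCombinations.module_hom class_ring V A.W"
    by (auto simp: LinearCombinations.module_hom_def J.coset_in_quot A.N.coset_in_quot
        J.quot_add J.quot_smult A.N.quot_add A.N.quot_smult)
  moreover have "?p v = ?p w \<longleftrightarrow> ?q v = ?q w" if "v \<in> carrier V" "w \<in> carrier V" for v w
    using that by (simp add: A.N.coset_eq_iff P.N.coset_eq_iff J.coset_in_quot J.quot_minus
        coset_in_state_kernel_iff)
  ultimately obtain \<phi> where \<phi>: "\<phi> \<in> LinearCombinations.module_hom class_ring A.W P.W"
    "bij_betw \<phi> (carrier A.W) (carrier P.W)" "\<And>v. v \<in> carrier V \<Longrightarrow> \<phi> (?p v) = ?q v"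
    using induced_module_iso[OF _ surj(1) P.N.coset_module_hom surj(2) module_axioms] by blast
  have "?p v \<in> cone A.W \<longleftrightarrow> ?q v \<in> cone P.W" if v: "v \<in> carrier V" for v
    using v re_part_herm[OF v] im_part_herm[OF v]
    by (simp add: A.coset_in_cone_iff P.coset_in_cone_iff J.coset_in_quot J.quot_re_part
        J.quot_im_part coset_in_arch_cone_iff coset_in_lineality_iff)
  then have "\<forall>X\<in>carrier A.W. X \<in> cone A.W \<longleftrightarrow> \<phi> X \<in> cone P.W"
    using \<phi>(3) by (simp flip: surj(1))
  then show ?thesis
    unfolding unitally_order_isomorphic_def using \<phi> unit_carrier by blast
qed

end

theorem proposition3p21:
  fixes V :: "'a ostar" and e :: 'a and J :: "'a set"
  assumes "ordered_star_vectorspace V"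
    and "order_unit V e"
    and "order_ideal V J"
  shows "order_ideal V (N_ideal V e J) \<and>
    ordered_star_vectorspace (N_quotient V e J) \<and>
    archimedean_order_unit (N_quotient V e J) (N_ideal V e J +>\<^bsub>V\<^esub> e) \<and>
    unitally_order_isomorphic (arch_quotient V e J) (arch_quotient_unit V e J)
      (N_quotient V e J) (N_ideal V e J +>\<^bsub>V\<^esub> e)"
proof -
  interpret order_ideal_quotient V e J
    using assms by (simp add: order_ideal_quotient_def order_ideal_quotient_axioms_def
        unital_star_vectorspace_def unital_star_vectorspace_axioms_def)
  show ?thesis
    unfolding N_ideal_eq N_quotient_eq arch_quotient_eq arch_quotient_unit_eq
    using order_ideal_N P.quot_ordered archimedean_N_quotient iso by blast
qed

end
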